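(* Let $C$ be a hyperelliptic curve of genus $g\ge2$ over a local field $K$ of odd residue characteristic that does not have potentially good reduction. Then for every integer $n$ with $1\le n\le n_{T_C,I_C}$, $$\mathrm{ord}(\mathrm{Inv}_{T_C,I_C,n}(C))=-2\sum_{m=1}^{n}K_m(C)\,(n+1-m)\,\delta_m(C).$$
   Context: $\mathrm{ord}$ is the valuation on $\bar K$ extending the normalised valuation of $K$. $C:y^2=f(x)$ with $f\in K[x]$ squarefree of degree $d=2g+2$, roots $x_1,\dots,x_d$, $\mathcal R=\{x_1,\dots,x_d\}$. Clusters: nonempty $\mathfrak s\subseteq\mathcal R$ of the form $\mathcal R\cap\{x:\mathrm{ord}(x-z)\ge r\}$; proper if $|\mathfrak s|>1$; depth $d_{\mathfrak s}=\min_{r,r'\in\mathfrak s}\mathrm{ord}(r-r')$; parent $P(\mathfrak s)$ = smallest cluster strictly containing $\mathfrak s\ne\mathcal R$; $\delta_{\mathfrak s}=d_{\mathfrak s}-d_{P(\mathfrak s)}$. Stable model tree $T_C$: vertex $v_{\mathfrak s}$ per cluster (including singletons); for $\mathfrak s\ne\mathcal R$ an edge $v_{\mathfrak s}v_{P(\mathfrak s)}$ of length $\delta_{\mathfrak s}$ if $\mathfrak s$ proper, no length if singleton. If $\mathcal R$ is the disjoint union of exactly two children $\mathfrak s_1,\mathfrak s_2$, remove $v_{\mathcal R}$ and join $v_{\mathfrak s_1},v_{\mathfrak s_2}$ by one edge of length $\delta_{\mathfrak s_1}+\delta_{\mathfrak s_2}$ if both proper (no length otherwise). $s_i$ = vertex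 of $\{x_i\}$ (singletons); other vertices proper; $\delta(v,w)$ = sum of lengths along the path between proper vertices. $C_{ij}$ is the path from $s_i$ to $s_j$; for distinct $i,j,k,l$ with $C_{ij},C_{kl}$ vertex-disjoint, $\delta(C_{ij},C_{kl})=\delta(v,w)$ where $v\in C_{ij},w\in C_{kl}$ are the endpoints of the shortest path joining them. $\delta_m(C)$ = $m$-th largest distinct value of $\delta(v,w)$, $v\ne w$ proper; $I_C$ = the total preorder on unordered pairs of distinct proper vertices induced by $\delta$; $n_{T_C,I_C}$ = number of distinct values. $S_m$ = set of unordered pairs $\{\{s_i,s_j\},\{s_k,s_l\}\}$ with $i,j,k,l$ distinct, $C_{ij},C_{kl}$ vertex-disjoint and $\delta(C_{ij},C_{kl})=\delta_m(C)$; $K_m(C)=\#S_m$. $(ij,kl)=\frac{(X_i-X_k)(X_i-X_l)(X_j-X_k)(X_j-X_l)}{(X_i-X_j)^2(X_k-X_l)^2}$, $R_{T_C,I_C,n}=\prod_{m=1}^n\prod_{\{\{s_i,s_j\},\{s_k,s_l\}\}\in S_m}(ij,kl)^{n-m+1}$; $S_d$ acts by $X_i\mapsto X_{\sigma(i)}$; $\mathrm{Inv}_{T_C,I_C,n}$ is the sum of the distinct elements of the $S_d$-orbit of $R_{T_C,I_C,n}$, and $\mathrm{Inv}_{T_C,I_C,n}(C)$ its value at $(x_1,\dots,x_d)$. *)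

theory Defs
  imports
    "HOL-Algebra.Algebraic_Closure_Type"
    "HOL-Computational_Algebra.Computational_Algebra"
    "HOL-Combinatorics.Permutations"
    "HOL-Library.Poly_Mapping"
    "HOL-Library.Extended_Real"
begin

section \<open>Local fields\<close>

definition valuation :: "('a::field \<Rightarrow> ereal) \<Rightarrow> bool" where
  "valuation v \<longleftrightarrow>
     (\<forall>a. v a = \<infinity> \<longleftrightarrow> a = 0) \<and> (\<forall>a. v a \<noteq> -\<infinity>) \<and>
     (\<forall>a b. v (a * b) = v a + v b) \<and> (\<forall>a b. min (v a) (v b) \<le> v (a + b))"

definition normalised_discrete :: "('a::field \<Rightarrow> ereal) \<Rightarrow> bool" where
  "normalised_discrete v \<longleftrightarrow> v ` (UNIV - {0}) = range (\<lambda>k::int. ereal (of_int k))"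

definition valuation_complete :: "('a::field \<Rightarrow> ereal) \<Rightarrow> bool" where
  "valuation_complete v \<longleftrightarrow>
     (\<forall>s::nat \<Rightarrow> 'a.
        (\<forall>B::real. \<exists>N. \<forall>m\<ge>N. \<forall>n\<ge>N. ereal B \<le> v (s m - s n)) \<longrightarrow>
        (\<exists>l. \<forall>B::real. \<exists>N. \<forall>n\<ge>N. ereal B \<le> v (s n - l)))"

definition residue_field :: "('a::field \<Rightarrow> ereal) \<Rightarrow> 'a set set" where
  "residue_field v = {a. 0 \<le> v a} // {(a, b). 0 \<le> v a \<and> 0 \<le> v b \<and> 0 < v (a - b)}"

definition local_field :: "('a::field \<Rightarrow> ereal) \<Rightarrow> bool" where
  "local_field v \<longleftrightarrow>
     valuation v \<and> normalised_discrete v \<and> valuation_complete v \<and> finite (residue_field v)"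

definition residue_char :: "('a::field \<Rightarrow> ereal) \<Rightarrow> nat" where
  "residue_char v = (LEAST p. 0 < p \<and> 0 < v (of_nat p))"


section \<open>Potentially good reduction of \<open>y\<^sup>2 = f(x)\<close>\<close>

definition finite_extension :: "'k::field alg_closure set \<Rightarrow> bool" where
  "finite_extension L \<longleftrightarrow>
     range to_ac \<subseteq> L \<and>
     (\<forall>a\<in>L. \<forall>b\<in>L. a + b \<in> L \<and> a - b \<in> L \<and> a * b \<in> L \<and> a / b \<in> L) \<and>
     (\<exists>B. finite B \<and> L = {\<Sum>b\<in>B. to_ac (c b) * b |c. True})"

text \<open>
  The change of variables \<open>x = (a X + b) / (c X + e)\<close>, \<open>y = Y / (u (c X + e)\<^sup>g\<^sup>+\<^sup>1)\<close> turns
  \<open>y\<^sup>2 = f(x)\<close>, with \<open>f\<close> of degree at most \<open>N = 2 g + 2\<close>, into \<open>Y\<^sup>2 = h(X)\<close> for the following \<open>h\<close>.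
\<close>

definition weierstrass_change ::
    "nat \<Rightarrow> 'a::field poly \<Rightarrow> 'a \<Rightarrow> 'a \<Rightarrow> 'a \<Rightarrow> 'a \<Rightarrow> 'a \<Rightarrow> 'a poly" where
  "weierstrass_change N f a b c e u =
     smult (u\<^sup>2) (\<Sum>i\<le>N. smult (coeff f i) ([:b, a:] ^ i * [:e, c:] ^ (N - i)))"

text \<open>
  Jacobian criterion for the reduction of the affine curve \<open>y\<^sup>2 = h(x)\<close>. Points over the (algebraically
  closed) residue field are represented by lifts to the ring of integers.
\<close>

definition smooth_reduction :: "('a::field \<Rightarrow> ereal) \<Rightarrow> 'a poly \<Rightarrow> bool" where
  "smooth_reduction ord h \<longleftrightarrow>
     (\<forall>i. 0 \<le> ord (coeff h i)) \<and>
     \<not> (\<exists>x y. 0 \<le> ord x \<and> 0 \<le> ord y \<and>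
           0 < ord (y\<^sup>2 - poly h x) \<and> 0 < ord (2 * y) \<and> 0 < ord (poly (pderiv h) x))"

text \<open>
  In odd residue characteristic and genus at least 2, a smooth proper model over the ring of integers of
  a finite extension is, after a further finite extension, a smooth Weierstrass model, glued from \<open>Y\<^sup>2 = h(X)\<close> and the chart \<open>W\<^sup>2 = Z\<^sup>N h(1/Z)\<close> at infinity.
\<close>

definition potentially_good_reduction ::
    "('k::field alg_closure \<Rightarrow> ereal) \<Rightarrow> nat \<Rightarrow> 'k poly \<Rightarrow> bool" where
  "potentially_good_reduction ord g f \<longleftrightarrow>
     (\<exists>L a b c e u. finite_extension L \<and> {a, b, c, e, u} \<subseteq> L \<and> a * e - b * c \<noteq> 0 \<and> u \<noteq> 0 \<and>
        (let N = 2 * g + 2;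
             h = weierstrass_change N (map_poly to_ac f) a b c e u
         in smooth_reduction ord h \<and>
            smooth_reduction ord (\<Sum>i\<le>N. monom (coeff h (N - i)) i)))"


section \<open>Clusters\<close>

definition clusters :: "('a::field \<Rightarrow> ereal) \<Rightarrow> 'a set \<Rightarrow> 'a set set" where
  "clusters ord R = {s. s \<noteq> {} \<and> (\<exists>z (r::real). s = R \<inter> {x. ereal r \<le> ord (x - z)})}"

abbreviation proper :: "'a set \<Rightarrow> bool" where
  "proper s \<equiv> 1 < card s"

definition depth :: "('a::field \<Rightarrow> ereal) \<Rightarrow> 'a set \<Rightarrow> ereal" where
  "depth ord s = Min {ord (r - r') |r r'. r \<in> s \<and> r' \<in> s}"

definition parent :: "('a::field \<Rightarrow> ereal) \<Rightarrow> 'a set \<Rightarrow> 'a set \<Rightarrow> 'a set" where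
  "parent ord R s = (LEAST t. t \<in> clusters ord R \<and> s \<subset> t)"

definition rel_depth :: "('a::field \<Rightarrow> ereal) \<Rightarrow> 'a set \<Rightarrow> 'a set \<Rightarrow> real" where
  "rel_depth ord R s = real_of_ereal (depth ord s - depth ord (parent ord R s))"

definition top_children :: "('a::field \<Rightarrow> ereal) \<Rightarrow> 'a set \<Rightarrow> 'a set set" where
  "top_children ord R = {s \<in> clusters ord R. s \<noteq> R \<and> parent ord R s = R}"

definition top_split :: "('a::field \<Rightarrow> ereal) \<Rightarrow> 'a set \<Rightarrow> 'a set \<Rightarrow> 'a set \<Rightarrow> bool" where
  "top_split ord R s1 s2 \<longleftrightarrow>
     s1 \<in> top_children ord R \<and> s2 \<in> top_children ord R \<and> s1 \<inter> s2 = {} \<and> s1 \<union> s2 = R"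


section \<open>The stable model tree\<close>

definition tree_verts :: "('a::field \<Rightarrow> ereal) \<Rightarrow> 'a set \<Rightarrow> 'a set set" where
  "tree_verts ord R =
     (if \<exists>s1 s2. top_split ord R s1 s2 then clusters ord R - {R} else clusters ord R)"

definition tree_edges :: "('a::field \<Rightarrow> ereal) \<Rightarrow> 'a set \<Rightarrow> 'a set set set" where
  "tree_edges ord R =
     {{s, parent ord R s} |s. s \<in> clusters ord R \<and> s \<noteq> R \<and> parent ord R s \<in> tree_verts ord R} \<union>
     {{s1, s2} |s1 s2. top_split ord R s1 s2}"

text \<open>Edges at singletons have no length, which is rendered by \<^const>\<open>undefined\<close>.\<close>

definition edge_length :: "('a::field \<Rightarrow> ereal) \<Rightarrow> 'a set \<Rightarrow> 'a set \<Rightarrow> 'a set \<Rightarrow> real" where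
  "edge_length ord R s t =
     (if \<not> (proper s \<and> proper t) then undefined
      else if s \<noteq> R \<and> t = parent ord R s then rel_depth ord R s
      else if t \<noteq> R \<and> s = parent ord R t then rel_depth ord R t
      else rel_depth ord R s + rel_depth ord R t)"

definition is_path :: "'v set set \<Rightarrow> 'v \<Rightarrow> 'v list \<Rightarrow> 'v \<Rightarrow> bool" where
  "is_path E v p w \<longleftrightarrow>
     p \<noteq> [] \<and> hd p = v \<and> last p = w \<and> distinct p \<and> successively (\<lambda>a b. {a, b} \<in> E) p"

definition tree_path :: "('a::field \<Rightarrow> ereal) \<Rightarrow> 'a set \<Rightarrow> 'a set \<Rightarrow> 'a set \<Rightarrow> 'a set list" where
  "tree_path ord R v w = (THE p. is_path (tree_edges ord R) v p w)"

definition tree_dist :: "('a::field \<Rightarrow> ereal) \<Rightarrow> 'a set \<Rightarrow> 'a set \<Rightarrow> 'a set \<Rightarrow> real" where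
  "tree_dist ord R v w =
     (let p = tree_path ord R v w in sum_list (map2 (edge_length ord R) p (tl p)))"

definition leaf_path :: "('a::field \<Rightarrow> ereal) \<Rightarrow> nat \<Rightarrow> (nat \<Rightarrow> 'a) \<Rightarrow> nat \<Rightarrow> nat \<Rightarrow> 'a set set" where
  "leaf_path ord d x i j = set (tree_path ord (x ` {1..d}) {x i} {x j})"

text \<open>
  The shortest path joining two disjoint paths is taken with respect to the number of edges, as edges
  at singletons have no length.
\<close>

definition path_dist :: "('a::field \<Rightarrow> ereal) \<Rightarrow> 'a set \<Rightarrow> 'a set set \<Rightarrow> 'a set set \<Rightarrow> real" where
  "path_dist ord R A B =
     (THE D. \<exists>v\<in>A. \<exists>w\<in>B. D = tree_dist ord R v w \<and>
        (\<forall>v'\<in>A. \<forall>w'\<in>B. length (tree_path ord R v w) \<le> length (tree_path ord R v' w')))"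

definition dist_values :: "('a::field \<Rightarrow> ereal) \<Rightarrow> nat \<Rightarrow> (nat \<Rightarrow> 'a) \<Rightarrow> real set" where
  "dist_values ord d x =
     (let R = x ` {1..d}
      in {tree_dist ord R v w |v w. v \<in> tree_verts ord R \<and> w \<in> tree_verts ord R \<and>
            proper v \<and> proper w \<and> v \<noteq> w})"

definition n_dist :: "('a::field \<Rightarrow> ereal) \<Rightarrow> nat \<Rightarrow> (nat \<Rightarrow> 'a) \<Rightarrow> nat" where
  "n_dist ord d x = card (dist_values ord d x)"

definition delta :: "('a::field \<Rightarrow> ereal) \<Rightarrow> nat \<Rightarrow> (nat \<Rightarrow> 'a) \<Rightarrow> nat \<Rightarrow> real" where
  "delta ord d x m = rev (sorted_list_of_set (dist_values ord d x)) ! (m - 1)"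

text \<open>The leaf \<open>s\<^sub>i = {x\<^sub>i}\<close> is represented by its index \<open>i\<close>.\<close>

definition S_pairs :: "('a::field \<Rightarrow> ereal) \<Rightarrow> nat \<Rightarrow> (nat \<Rightarrow> 'a) \<Rightarrow> nat \<Rightarrow> nat set set set" where
  "S_pairs ord d x m =
     {{{i, j}, {k, l}} |i j k l.
        {i, j, k, l} \<subseteq> {1..d} \<and> distinct [i, j, k, l] \<and>
        leaf_path ord d x i j \<inter> leaf_path ord d x k l = {} \<and>
        path_dist ord (x ` {1..d}) (leaf_path ord d x i j) (leaf_path ord d x k l) = delta ord d x m}"

definition K_count :: "('a::field \<Rightarrow> ereal) \<Rightarrow> nat \<Rightarrow> (nat \<Rightarrow> 'a) \<Rightarrow> nat \<Rightarrow> nat" where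
  "K_count ord d x m = card (S_pairs ord d x m)"


section \<open>Rational functions in \<open>X\<^sub>0, X\<^sub>1, X\<^sub>2, \<dots>\<close>\<close>

type_synonym int_mpoly = "(nat \<Rightarrow>\<^sub>0 nat) \<Rightarrow>\<^sub>0 int"

type_synonym ratfun = "int_mpoly fract"

definition X_var :: "nat \<Rightarrow> ratfun" where
  "X_var i = Fract (Poly_Mapping.single (Poly_Mapping.single i 1) 1) 1"

definition mpoly_eval :: "(nat \<Rightarrow> 'b::comm_ring_1) \<Rightarrow> int_mpoly \<Rightarrow> 'b" where
  "mpoly_eval \<phi> p =
     (\<Sum>m\<in>Poly_Mapping.keys p. of_int (Poly_Mapping.lookup p m) *
        (\<Prod>i\<in>Poly_Mapping.keys m. \<phi> i ^ Poly_Mapping.lookup m i))"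

text \<open>Independent of the representation of \<open>r\<close> as a fraction whose denominator does not vanish at \<open>\<phi>\<close>.\<close>

definition ratfun_eval :: "(nat \<Rightarrow> 'b::field) \<Rightarrow> ratfun \<Rightarrow> 'b" where
  "ratfun_eval \<phi> r =
     (THE z. \<exists>p q. r = Fract p q \<and> mpoly_eval \<phi> q \<noteq> 0 \<and> z = mpoly_eval \<phi> p / mpoly_eval \<phi> q)"

definition perm_act :: "(nat \<Rightarrow> nat) \<Rightarrow> ratfun \<Rightarrow> ratfun" where
  "perm_act \<sigma> r = ratfun_eval (\<lambda>i. X_var (\<sigma> i)) r"

definition cross :: "nat \<Rightarrow> nat \<Rightarrow> nat \<Rightarrow> nat \<Rightarrow> ratfun" where
  "cross i j k l =
     (X_var i - X_var k) * (X_var i - X_var l) * (X_var j - X_var k) * (X_var j - X_var l) /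
     ((X_var i - X_var j)\<^sup>2 * (X_var k - X_var l)\<^sup>2)"

text \<open>\<^const>\<open>cross\<close> is invariant under swapping \<open>i, j\<close>, swapping \<open>k, l\<close>, and swapping the two pairs.\<close>

definition cross_pair :: "nat set set \<Rightarrow> ratfun" where
  "cross_pair P = (THE r. \<exists>i j k l. P = {{i, j}, {k, l}} \<and> r = cross i j k l)"


section \<open>The invariants\<close>

definition R_fun :: "('a::field \<Rightarrow> ereal) \<Rightarrow> nat \<Rightarrow> (nat \<Rightarrow> 'a) \<Rightarrow> nat \<Rightarrow> ratfun" where
  "R_fun ord d x n = (\<Prod>m=1..n. \<Prod>P\<in>S_pairs ord d x m. cross_pair P ^ (n - m + 1))"

definition Inv :: "('a::field \<Rightarrow> ereal) \<Rightarrow> nat \<Rightarrow> (nat \<Rightarrow> 'a) \<Rightarrow> nat \<Rightarrow> ratfun" where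
  "Inv ord d x n = \<Sum>{perm_act \<sigma> (R_fun ord d x n) |\<sigma>. \<sigma> permutes {1..d}}"

end

theory Submission
  imports Defs
begin

text \<open>
  Give every singleton a common finite height above the depths of all proper clusters. Then the tree
  is a metric space in which \<open>\<delta>({a}, {b}) = const - 2 ord(a - b)\<close> for roots \<open>a \<noteq> b\<close>, so \<open>2 ord (ij,kl)\<close>
  equals \<open>2 \<delta>(s\<^sub>i, s\<^sub>j) + 2 \<delta>(s\<^sub>k, s\<^sub>l)\<close> minus the sum of the distances from \<open>s\<^sub>i\<close>, \<open>s\<^sub>j\<close> to \<open>s\<^sub>k\<close>, \<open>s\<^sub>l\<close>.
  In any metric tree this is \<open>- 4 \<delta>(C\<^sub>i\<^sub>j, C\<^sub>k\<^sub>l)\<close> if the paths \<open>C\<^sub>i\<^sub>j\<close> and \<open>C\<^sub>k\<^sub>l\<close> are disjoint, and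
  nonnegative by the triangle inequality if they meet.

  The order of \<open>R\<^sub>n\<close> is the sum over \<open>k \<le> n\<close> of the orders of all \<open>(ij,kl)\<close> in \<open>S\<^sub>1 \<union> \<dots> \<union> S\<^sub>k\<close>, which is
  the set of all pairs of order at most \<open>- 2 \<delta>\<^sub>k\<close>. A permutation replaces this sublevel set by another
  set of the same size, so each summand strictly increases unless the sublevel set is preserved. If
  all of them are preserved, \<open>R\<^sub>n\<close> is fixed. Hence \<open>R\<^sub>n\<close> is the unique element of least order in its
  orbit.
\<close>

section \<open>Evaluation of rational functions\<close>

definition mono_eval :: "(nat \<Rightarrow> 'b::comm_ring_1) \<Rightarrow> (nat \<Rightarrow>\<^sub>0 nat) \<Rightarrow> 'b" where
  "mono_eval \<phi> m = (\<Prod>i\<in>Poly_Mapping.keys m. \<phi> i ^ Poly_Mapping.lookup m i)"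

lemma mono_eval_superset:
  assumes "finite A" "Poly_Mapping.keys m \<subseteq> A"
  shows "mono_eval \<phi> m = (\<Prod>i\<in>A. \<phi> i ^ Poly_Mapping.lookup m i)"
  unfolding mono_eval_def
  by (rule prod.mono_neutral_left) (use assms in \<open>auto simp: in_keys_iff\<close>)

lemma mono_eval_add: "mono_eval \<phi> (m + n) = mono_eval \<phi> m * mono_eval \<phi> n"
proof -
  let ?A = "Poly_Mapping.keys m \<union> Poly_Mapping.keys n"
  have "Poly_Mapping.keys (m + n) \<subseteq> ?A" by (rule Poly_Mapping.keys_add)
  then show ?thesis
    by (simp add: mono_eval_superset[of ?A] lookup_add power_add prod.distrib)
qed

lemma mpoly_eval_superset:
  assumes "finite A" "Poly_Mapping.keys p \<subseteq> A"
  shows "mpoly_eval \<phi> p = (\<Sum>m\<in>A. of_int (Poly_Mapping.lookup p m) * mono_eval \<phi> m)"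
  unfolding mpoly_eval_def mono_eval_def[symmetric]
  by (rule sum.mono_neutral_left) (use assms in \<open>auto simp: in_keys_iff\<close>)

lemma mpoly_eval_0 [simp]: "mpoly_eval \<phi> 0 = 0"
  by (simp add: mpoly_eval_def)

lemma mpoly_eval_single: "mpoly_eval \<phi> (Poly_Mapping.single m c) = of_int c * mono_eval \<phi> m"
  using mpoly_eval_superset[of "{m}" "Poly_Mapping.single m c" \<phi>] by simp

lemma mpoly_eval_1 [simp]: "mpoly_eval \<phi> 1 = 1"
  using mpoly_eval_single[of \<phi> 0 1] by (simp add: mono_eval_def)

lemma mpoly_eval_diff: "mpoly_eval \<phi> (p - q) = mpoly_eval \<phi> p - mpoly_eval \<phi> q"
proof -
  let ?A = "Poly_Mapping.keys p \<union> Poly_Mapping.keys q"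
  have "Poly_Mapping.keys (p - q) \<subseteq> ?A" by (rule keys_diff)
  then show ?thesis
    by (simp add: mpoly_eval_superset[of ?A] lookup_minus algebra_simps sum_subtractf)
qed

lemma mpoly_eval_add: "mpoly_eval \<phi> (p + q) = mpoly_eval \<phi> p + mpoly_eval \<phi> q"
  using mpoly_eval_diff[of \<phi> "p + q" q] by simp

lemma mpoly_eval_mult: "mpoly_eval \<phi> (p * q) = mpoly_eval \<phi> p * mpoly_eval \<phi> q"
proof -
  have monomial: "mpoly_eval \<phi> (frag_of m * q) = mpoly_eval \<phi> (frag_of m) * mpoly_eval \<phi> q" for m
  proof (rule frag_induction[of q UNIV])
    fix n
    show "mpoly_eval \<phi> (frag_of m * frag_of n) = mpoly_eval \<phi> (frag_of m) * mpoly_eval \<phi> (frag_of n)"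
      by (simp add: mult_single mpoly_eval_single mono_eval_add)
  qed (simp_all add: mpoly_eval_diff algebra_simps)
  show ?thesis
    by (rule frag_induction[of p UNIV]) (simp_all add: monomial mpoly_eval_diff left_diff_distrib)
qed

definition regular_at :: "(nat \<Rightarrow> 'b::field) \<Rightarrow> ratfun \<Rightarrow> bool" where
  "regular_at \<phi> r \<longleftrightarrow> (\<exists>p q. r = Fract p q \<and> mpoly_eval \<phi> q \<noteq> 0)"

lemma regular_at_Fract: "mpoly_eval \<phi> q \<noteq> 0 \<Longrightarrow> regular_at \<phi> (Fract p q)"
  by (auto simp: regular_at_def)

lemma ratfun_eval_Fract:
  assumes "mpoly_eval \<phi> q \<noteq> 0"
  shows "ratfun_eval \<phi> (Fract p q) = mpoly_eval \<phi> p / mpoly_eval \<phi> q"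
  unfolding ratfun_eval_def
proof (rule the_equality)
  fix z
  assume "\<exists>p' q'. Fract p q = Fract p' q' \<and> mpoly_eval \<phi> q' \<noteq> 0 \<and> z = mpoly_eval \<phi> p' / mpoly_eval \<phi> q'"
  then obtain p' q' where eq: "Fract p q = Fract p' q'" "mpoly_eval \<phi> q' \<noteq> 0"
    "z = mpoly_eval \<phi> p' / mpoly_eval \<phi> q'" by blast
  have "q \<noteq> 0" "q' \<noteq> 0" using assms eq(2) by auto
  then have "p * q' = p' * q" using eq(1) by (simp add: eq_fract)
  then have "mpoly_eval \<phi> p * mpoly_eval \<phi> q' = mpoly_eval \<phi> p' * mpoly_eval \<phi> q"
    by (metis mpoly_eval_mult)
  then show "z = mpoly_eval \<phi> p / mpoly_eval \<phi> q"
    using assms eq by (simp add: frac_eq_eq)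
qed (use assms in blast)

lemma regular_atE:
  assumes "regular_at \<phi> r"
  obtains p q where "r = Fract p q" "q \<noteq> 0" "mpoly_eval \<phi> q \<noteq> 0"
    "ratfun_eval \<phi> r = mpoly_eval \<phi> p / mpoly_eval \<phi> q"
  using assms by (metis regular_at_def ratfun_eval_Fract mpoly_eval_0)

lemma regular_at_0: "regular_at \<phi> 0"
  and ratfun_eval_0: "ratfun_eval \<phi> 0 = 0"
  and regular_at_1: "regular_at \<phi> 1"
  and ratfun_eval_1: "ratfun_eval \<phi> 1 = 1"
  by (simp_all add: Zero_fract_def One_fract_def ratfun_eval_Fract regular_at_Fract)

lemma regular_at_X_var: "regular_at \<phi> (X_var i)"
  and ratfun_eval_X_var: "ratfun_eval \<phi> (X_var i) = \<phi> i"
  by (simp_all add: X_var_def ratfun_eval_Fract regular_at_Fract mpoly_eval_single mono_eval_def)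

context
  fixes \<phi> :: "nat \<Rightarrow> 'b::field" and r s :: ratfun
  assumes regular: "regular_at \<phi> r" "regular_at \<phi> s"
begin

lemma regular_at_add: "regular_at \<phi> (r + s)"
  and ratfun_eval_add: "ratfun_eval \<phi> (r + s) = ratfun_eval \<phi> r + ratfun_eval \<phi> s"
  using regular
  by (auto elim!: regular_atE intro!: regular_at_Fract
      simp: ratfun_eval_Fract mpoly_eval_mult mpoly_eval_add add_frac_eq)

lemma regular_at_diff: "regular_at \<phi> (r - s)"
  and ratfun_eval_diff: "ratfun_eval \<phi> (r - s) = ratfun_eval \<phi> r - ratfun_eval \<phi> s"
  using regular
  by (auto elim!: regular_atE intro!: regular_at_Fract
      simp: ratfun_eval_Fract mpoly_eval_mult mpoly_eval_diff diff_frac_eq)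

lemma regular_at_mult: "regular_at \<phi> (r * s)"
  and ratfun_eval_mult: "ratfun_eval \<phi> (r * s) = ratfun_eval \<phi> r * ratfun_eval \<phi> s"
  using regular
  by (auto elim!: regular_atE intro!: regular_at_Fract simp: ratfun_eval_Fract mpoly_eval_mult)

lemma regular_at_divide: "ratfun_eval \<phi> s \<noteq> 0 \<Longrightarrow> regular_at \<phi> (r / s)"
  and ratfun_eval_divide:
    "ratfun_eval \<phi> s \<noteq> 0 \<Longrightarrow> ratfun_eval \<phi> (r / s) = ratfun_eval \<phi> r / ratfun_eval \<phi> s"
  using regular
  by (auto elim!: regular_atE intro!: regular_at_Fract simp: ratfun_eval_Fract mpoly_eval_mult)

end

context
  fixes \<phi> :: "nat \<Rightarrow> 'b::field" and h :: "'i \<Rightarrow> ratfun" and A :: "'i set"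
  assumes regular: "\<And>a. a \<in> A \<Longrightarrow> regular_at \<phi> (h a)"
begin

lemma ratfun_eval_sum: "ratfun_eval \<phi> (\<Sum>a\<in>A. h a) = (\<Sum>a\<in>A. ratfun_eval \<phi> (h a))"
proof -
  have "regular_at \<phi> (\<Sum>a\<in>A. h a) \<and> ratfun_eval \<phi> (\<Sum>a\<in>A. h a) = (\<Sum>a\<in>A. ratfun_eval \<phi> (h a))"
    using regular
    by (induction A rule: infinite_finite_induct)
      (simp_all add: regular_at_0 ratfun_eval_0 regular_at_add ratfun_eval_add)
  then show ?thesis ..
qed

lemma regular_at_prod: "regular_at \<phi> (\<Prod>a\<in>A. h a)"
  and ratfun_eval_prod: "ratfun_eval \<phi> (\<Prod>a\<in>A. h a) = (\<Prod>a\<in>A. ratfun_eval \<phi> (h a))"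
proof -
  have "regular_at \<phi> (\<Prod>a\<in>A. h a) \<and> ratfun_eval \<phi> (\<Prod>a\<in>A. h a) = (\<Prod>a\<in>A. ratfun_eval \<phi> (h a))"
    using regular
    by (induction A rule: infinite_finite_induct)
      (simp_all add: regular_at_1 ratfun_eval_1 regular_at_mult ratfun_eval_mult)
  then show "regular_at \<phi> (\<Prod>a\<in>A. h a)" "ratfun_eval \<phi> (\<Prod>a\<in>A. h a) = (\<Prod>a\<in>A. ratfun_eval \<phi> (h a))"
    by auto
qed

end

lemma inj_X_var: "inj X_var"
proof (rule injI)
  fix i j assume "X_var i = X_var j"
  then have "Poly_Mapping.single (Poly_Mapping.single i (1::nat)) (1::int) =
      Poly_Mapping.single (Poly_Mapping.single j 1) 1"
    by (simp add: X_var_def eq_fract)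
  then show "i = j"
    by (metis keys_single singleton_inject zero_neq_one)
qed

definition cross_value :: "'b::field \<Rightarrow> 'b \<Rightarrow> 'b \<Rightarrow> 'b \<Rightarrow> 'b" where
  "cross_value a b c e =
     (a - c) * (a - e) * (b - c) * (b - e) / ((a - b)\<^sup>2 * (c - e)\<^sup>2)"

lemma cross_value_nonzero: "distinct [a, b, c, e] \<Longrightarrow> cross_value a b c e \<noteq> 0"
  by (simp add: cross_value_def)

lemma
  assumes "\<phi> i \<noteq> \<phi> j" "\<phi> k \<noteq> \<phi> l"
  shows regular_at_cross: "regular_at \<phi> (cross i j k l)"
    and ratfun_eval_cross: "ratfun_eval \<phi> (cross i j k l) = cross_value (\<phi> i) (\<phi> j) (\<phi> k) (\<phi> l)"
  unfolding cross_def cross_value_def power2_eq_square using assms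
  by (simp_all add: regular_at_X_var ratfun_eval_X_var regular_at_diff ratfun_eval_diff
      regular_at_mult ratfun_eval_mult regular_at_divide ratfun_eval_divide)

lemma cross_pair_eq: "cross_pair {{i, j}, {k, l}} = cross i j k l"
  unfolding cross_pair_def
proof (rule the_equality)
  fix r assume "\<exists>i' j' k' l'. {{i, j}, {k, l}} = {{i', j'}, {k', l'}} \<and> r = cross i' j' k' l'"
  then obtain i' j' k' l' where P: "{{i, j}, {k, l}} = {{i', j'}, {k', l'}}"
    and r: "r = cross i' j' k' l'"
    by blast
  from P have "({i, j} = {i', j'} \<and> {k, l} = {k', l'}) \<or> ({i, j} = {k', l'} \<and> {k, l} = {i', j'})"
    by (simp add: doubleton_eq_iff[of "{i, j}"])
  then show "r = cross i j k l"
    unfolding r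
    by (auto simp: doubleton_eq_iff cross_def power2_commute mult_ac)
      (simp_all add: field_simps power2_eq_square)
qed blast

definition quads :: "'i set \<Rightarrow> 'i set set set" where
  "quads A = {{{i, j}, {k, l}} |i j k l. {i, j, k, l} \<subseteq> A \<and> distinct [i, j, k, l]}"

lemma quadsE:
  assumes "P \<in> quads A"
  obtains i j k l where "P = {{i, j}, {k, l}}" "{i, j, k, l} \<subseteq> A" "distinct [i, j, k, l]"
  using assms unfolding quads_def by blast

lemma quadsI: "{i, j, k, l} \<subseteq> A \<Longrightarrow> distinct [i, j, k, l] \<Longrightarrow> {{i, j}, {k, l}} \<in> quads A"
  unfolding quads_def by blast

lemma finite_quads:
  assumes "finite A"
  shows "finite (quads A)"
proof (rule finite_subset)
  show "quads A \<subseteq> Pow (Pow A)" by (auto simp: quads_def)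
qed (use assms in simp)

lemma regular_at_cross_pair:
  assumes "inj_on \<phi> A" "P \<in> quads A"
  shows "regular_at \<phi> (cross_pair P)"
  using assms(2)
proof (rule quadsE)
  fix i j k l assume P: "P = {{i, j}, {k, l}}" "{i, j, k, l} \<subseteq> A" "distinct [i, j, k, l]"
  then have "\<phi> i \<noteq> \<phi> j" "\<phi> k \<noteq> \<phi> l" using assms(1) by (auto simp: inj_on_eq_iff)
  then show ?thesis unfolding P(1) cross_pair_eq by (rule regular_at_cross)
qed

lemma ratfun_eval_cross_pair:
  assumes "inj_on \<phi> A" "{i, j, k, l} \<subseteq> A" "distinct [i, j, k, l]"
  shows "ratfun_eval \<phi> (cross_pair {{i, j}, {k, l}}) = cross_value (\<phi> i) (\<phi> j) (\<phi> k) (\<phi> l)"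
  unfolding cross_pair_eq by (rule ratfun_eval_cross) (use assms in \<open>auto simp: inj_on_eq_iff\<close>)

abbreviation act :: "('i \<Rightarrow> 'i) \<Rightarrow> 'i set set \<Rightarrow> 'i set set" where
  "act \<sigma> \<equiv> (`) ((`) \<sigma>)"

lemma inj_act: "inj \<sigma> \<Longrightarrow> inj (act \<sigma>)"
  using inj_on_image_Pow[of \<sigma> UNIV] inj_on_image_Pow[of "(`) \<sigma>" UNIV] by simp

lemma act_quads:
  assumes "inj_on \<sigma> A" "\<sigma> ` A \<subseteq> B" "P \<in> quads A"
  shows "act \<sigma> P \<in> quads B"
  using assms(3)
proof (rule quadsE)
  fix i j k l assume P: "P = {{i, j}, {k, l}}" "{i, j, k, l} \<subseteq> A" "distinct [i, j, k, l]"
  have "{\<sigma> i, \<sigma> j, \<sigma> k, \<sigma> l} \<subseteq> B" using P(2) assms(2) by blast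
  moreover have "distinct [\<sigma> i, \<sigma> j, \<sigma> k, \<sigma> l]" using P(2,3) assms(1) by (auto simp: inj_on_eq_iff)
  ultimately have "{{\<sigma> i, \<sigma> j}, {\<sigma> k, \<sigma> l}} \<in> quads B" by (rule quadsI)
  then show ?thesis by (simp add: P(1))
qed

lemma perm_act_cross_pair:
  assumes "inj_on \<sigma> A" "P \<in> quads A"
  shows "perm_act \<sigma> (cross_pair P) = cross_pair (act \<sigma> P)"
  using assms(2)
proof (rule quadsE)
  fix i j k l assume P: "P = {{i, j}, {k, l}}" "{i, j, k, l} \<subseteq> A" "distinct [i, j, k, l]"
  have "inj_on (\<lambda>i. X_var (\<sigma> i)) A" using assms(1) inj_X_var by (auto simp: inj_on_def dest: injD)
  then have "perm_act \<sigma> (cross_pair P) = cross (\<sigma> i) (\<sigma> j) (\<sigma> k) (\<sigma> l)"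
    unfolding perm_act_def P(1)
    by (simp add: ratfun_eval_cross_pair[OF _ P(2,3)] cross_value_def cross_def)
  then show ?thesis by (simp add: P(1) cross_pair_eq)
qed

definition cross_prod :: "(nat \<Rightarrow> nat set set set) \<Rightarrow> nat \<Rightarrow> ratfun" where
  "cross_prod T n = (\<Prod>k=1..n. \<Prod>P\<in>T k. cross_pair P)"

lemma cross_prod_cong: "(\<And>k. k \<in> {1..n} \<Longrightarrow> T k = T' k) \<Longrightarrow> cross_prod T n = cross_prod T' n"
  unfolding cross_prod_def by (rule prod.cong) simp_all

lemma
  assumes "inj_on \<phi> A" "\<And>k. k \<in> {1..n} \<Longrightarrow> T k \<subseteq> quads A"
  shows regular_at_cross_prod: "regular_at \<phi> (cross_prod T n)"
    and ratfun_eval_cross_prod: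
      "ratfun_eval \<phi> (cross_prod T n) = (\<Prod>k=1..n. \<Prod>P\<in>T k. ratfun_eval \<phi> (cross_pair P))"
proof -
  have regular: "regular_at \<phi> (cross_pair P)" if "k \<in> {1..n}" "P \<in> T k" for k P
    using regular_at_cross_pair[OF assms(1)] assms(2) that by blast
  show "regular_at \<phi> (cross_prod T n)"
    unfolding cross_prod_def by (intro regular_at_prod regular)
  have "ratfun_eval \<phi> (cross_prod T n) = (\<Prod>k=1..n. ratfun_eval \<phi> (\<Prod>P\<in>T k. cross_pair P))"
    unfolding cross_prod_def by (intro ratfun_eval_prod regular_at_prod regular)
  also have "\<dots> = (\<Prod>k=1..n. \<Prod>P\<in>T k. ratfun_eval \<phi> (cross_pair P))"
    by (intro prod.cong refl ratfun_eval_prod regular)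
  finally show "ratfun_eval \<phi> (cross_prod T n) = (\<Prod>k=1..n. \<Prod>P\<in>T k. ratfun_eval \<phi> (cross_pair P))" .
qed

lemma perm_act_cross_prod:
  assumes "inj \<sigma>" "\<And>k. k \<in> {1..n} \<Longrightarrow> T k \<subseteq> quads A"
  shows "perm_act \<sigma> (cross_prod T n) = cross_prod (\<lambda>k. act \<sigma> ` T k) n"
proof -
  have inj: "inj_on \<sigma> A" using assms(1) inj_on_subset by blast
  have "inj_on (\<lambda>i. X_var (\<sigma> i)) A" using inj inj_X_var by (auto simp: inj_on_def)
  from ratfun_eval_cross_prod[OF this assms(2)]
  have "perm_act \<sigma> (cross_prod T n) = (\<Prod>k=1..n. \<Prod>P\<in>T k. perm_act \<sigma> (cross_pair P))"
    unfolding perm_act_def by simp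
  also have "\<dots> = (\<Prod>k=1..n. \<Prod>P\<in>T k. cross_pair (act \<sigma> P))"
    using perm_act_cross_pair[OF inj] assms(2) by (intro prod.cong refl) blast
  also have "\<dots> = cross_prod (\<lambda>k. act \<sigma> ` T k) n"
    unfolding cross_prod_def
    using inj_on_subset[OF inj_act[OF assms(1)] subset_UNIV] by (simp add: prod.reindex)
  finally show ?thesis .
qed

section \<open>Valued fields\<close>

locale valued_field =
  fixes ord :: "'a::field \<Rightarrow> ereal"
  assumes valuation: "valuation ord"
begin

lemma ord_eq_PInfty_iff: "ord a = \<infinity> \<longleftrightarrow> a = 0"
  and ord_neq_MInfty: "ord a \<noteq> -\<infinity>"
  and ord_mult: "ord (a * b) = ord a + ord b"
  and ord_add: "min (ord a) (ord b) \<le> ord (a + b)"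
  using valuation by (auto simp: valuation_def)

definition rord :: "'a \<Rightarrow> real" where
  "rord a = real_of_ereal (ord a)"

lemma ord_eq_rord: "a \<noteq> 0 \<Longrightarrow> ord a = ereal (rord a)"
  using ord_eq_PInfty_iff[of a] ord_neq_MInfty[of a] by (cases "ord a") (auto simp: rord_def)

lemma ord_0 [simp]: "ord 0 = \<infinity>"
  by (simp add: ord_eq_PInfty_iff)

lemma rord_mult: "a \<noteq> 0 \<Longrightarrow> b \<noteq> 0 \<Longrightarrow> rord (a * b) = rord a + rord b"
  using ord_mult[of a b] by (simp add: ord_eq_rord)

lemma rord_1 [simp]: "rord 1 = 0"
  using rord_mult[of 1 1] by simp

lemma rord_divide: "a \<noteq> 0 \<Longrightarrow> b \<noteq> 0 \<Longrightarrow> rord (a / b) = rord a - rord b"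
  using rord_mult[of "a / b" b] by simp

lemma rord_power: "a \<noteq> 0 \<Longrightarrow> rord (a ^ n) = real n * rord a"
  by (induction n) (simp_all add: rord_mult algebra_simps)

lemma rord_prod: "(\<And>a. a \<in> A \<Longrightarrow> h a \<noteq> 0) \<Longrightarrow> rord (\<Prod>a\<in>A. h a) = (\<Sum>a\<in>A. rord (h a))"
  by (induction A rule: infinite_finite_induct) (simp_all add: rord_mult)

lemma ord_minus [simp]: "ord (- a) = ord a"
proof (cases "a = 0")
  case False
  have "rord (-1) = 0" using rord_mult[of "-1" "-1"] by simp
  then show ?thesis using rord_mult[of "-1" a] False by (simp add: ord_eq_rord)
qed simp

lemma ord_minus_commute: "ord (a - b) = ord (b - a)"
  using ord_minus[of "a - b"] by simp

lemma ord_diff_trans: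
  assumes "r \<le> ord (a - b)" "r \<le> ord (b - c)"
  shows "r \<le> ord (a - c)"
proof -
  have "r \<le> min (ord (a - b)) (ord (b - c))" using assms by simp
  also have "\<dots> \<le> ord (a - c)" using ord_add[of "a - b" "b - c"] by simp
  finally show ?thesis .
qed

lemma ord_sum_greater:
  assumes "\<And>y. y \<in> Y \<Longrightarrow> ereal r < ord (h y)"
  shows "ereal r < ord (\<Sum>y\<in>Y. h y)"
  using assms
proof (induction Y rule: infinite_finite_induct)
  case (insert a Y)
  then have "ereal r < min (ord (h a)) (ord (\<Sum>y\<in>Y. h y))" by simp
  also have "\<dots> \<le> ord (\<Sum>y\<in>insert a Y. h y)" using ord_add insert by simp
  finally show ?case .
qed auto

lemma ord_add_eq_left:
  assumes "ord a < ord b"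
  shows "ord (a + b) = ord a"
proof (rule antisym)
  have "min (ord (a + b)) (ord b) \<le> ord a" using ord_add[of "a + b" "- b"] by simp
  then show "ord (a + b) \<le> ord a" using assms by (simp add: min_def split: if_splits)
  show "ord a \<le> ord (a + b)" using ord_add[of a b] assms by (simp add: min_def split: if_splits)
qed

lemma ord_sum_unique_min:
  assumes "finite Y" "y \<in> Y" "h y \<noteq> 0" "\<And>z. z \<in> Y \<Longrightarrow> z \<noteq> y \<Longrightarrow> ord (h y) < ord (h z)"
  shows "ord (\<Sum>z\<in>Y. h z) = ord (h y)"
proof -
  have "ord (h y) < ord (\<Sum>z\<in>Y - {y}. h z)"
    unfolding ord_eq_rord[OF assms(3)]
    by (rule ord_sum_greater) (use assms(3,4) in \<open>auto simp: ord_eq_rord\<close>)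
  then show ?thesis using assms(1,2) ord_add_eq_left by (simp add: sum.remove)
qed

lemma rord_cross_value:
  assumes "distinct [a, b, c, e]"
  shows "rord (cross_value a b c e) =
    rord (a - c) + rord (a - e) + rord (b - c) + rord (b - e) - 2 * rord (a - b) - 2 * rord (c - e)"
  unfolding cross_value_def using assms
  by (simp add: rord_divide rord_mult rord_power)

end

section \<open>Graphs with unique paths\<close>

lemma is_path_self_iff: "is_path E v p v \<longleftrightarrow> p = [v]"
proof
  assume "is_path E v p v"
  then show "p = [v]" unfolding is_path_def by (cases p) (auto split: if_splits)
qed (simp add: is_path_def)

lemma is_path_rev: "is_path E v p w \<Longrightarrow> is_path E w (rev p) v"
  by (auto simp: is_path_def hd_rev last_rev insert_commute)

lemma is_path_append_iff:
  "is_path E v (p @ m # q) w \<longleftrightarrow>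
     is_path E v (p @ [m]) m \<and> is_path E m (m # q) w \<and> set p \<inter> set q = {}"
  by (auto simp: is_path_def hd_append successively_append_iff)

lemma is_path_Cons_iff:
  "is_path E v (v # u # q) w \<longleftrightarrow> {v, u} \<in> E \<and> v \<notin> set (u # q) \<and> is_path E u (u # q) w"
  by (auto simp: is_path_def)

lemma is_path_cases:
  assumes "is_path E v p w" "v \<noteq> w"
  obtains u q where "p = v # u # q" "{v, u} \<in> E" "v \<notin> set (u # q)" "is_path E u (u # q) w"
proof -
  obtain q where p: "p = v # q" using assms(1) by (cases p) (auto simp: is_path_def)
  with assms obtain u q' where "q = u # q'" by (cases q) (auto simp: is_path_def)
  then show thesis using that assms(1) p by (simp add: is_path_Cons_iff)
qed

locale parent_tree =
  fixes V :: "'v set" and up :: "'v \<Rightarrow> 'v" and rank :: "'v \<Rightarrow> nat"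
  assumes up_vertex: "v \<in> V \<Longrightarrow> 0 < rank v \<Longrightarrow> up v \<in> V"
    and rank_up: "v \<in> V \<Longrightarrow> 0 < rank v \<Longrightarrow> rank (up v) < rank v"
    and unique_root: "v \<in> V \<Longrightarrow> w \<in> V \<Longrightarrow> rank v = 0 \<Longrightarrow> rank w = 0 \<Longrightarrow> v = w"
begin

definition edges :: "'v set set" where
  "edges = (\<lambda>v. {v, up v}) ` {v \<in> V. 0 < rank v}"

lemma edge_cases:
  assumes "{v, u} \<in> edges"
  obtains "v \<in> V" "0 < rank v" "u = up v" | "u \<in> V" "0 < rank u" "v = up u"
  using assms by (auto simp: edges_def doubleton_eq_iff)

lemma edge_upI: "v \<in> V \<Longrightarrow> 0 < rank v \<Longrightarrow> {v, up v} \<in> edges"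
  by (auto simp: edges_def)

lemma descending_path_rank_less:
  assumes "is_path edges v (v # u # q) w" "u \<in> V" "0 < rank u" "v = up u"
  shows "rank v < rank w"
  using assms
proof (induction q arbitrary: v u)
  case Nil
  then show ?case using rank_up by (simp add: is_path_def)
next
  case (Cons t q)
  have path: "is_path edges u (u # t # q) w" and "t \<noteq> v" and edge: "{u, t} \<in> edges"
    using Cons.prems(1) by (auto simp: is_path_Cons_iff)
  from edge have "rank u < rank w"
  proof (cases rule: edge_cases)
    case 1
    then show ?thesis using \<open>t \<noteq> v\<close> Cons.prems(4) by simp
  next
    case 2
    then show ?thesis using Cons.IH[OF path] by simp
  qed
  then show ?case using rank_up Cons.prems(2-4) by fastforce
qed

lemma path_ascends:
  assumes "is_path edges v p w" "v \<noteq> w" "rank w \<le> rank v"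
  obtains q where "p = v # q" "is_path edges (up v) q w"
proof -
  obtain u q where p: "p = v # u # q" "{v, u} \<in> edges" "is_path edges u (u # q) w"
    using is_path_cases[OF assms(1,2)] by metis
  from p(2) have "u = up v"
  proof (cases rule: edge_cases)
    case 2
    then have "rank v < rank w" using descending_path_rank_less assms(1) p(1) by blast
    then show ?thesis using assms(3) by simp
  qed
  then show thesis using that p by simp
qed

lemma rank_pair_induct [consumes 2, case_names refl commute ascend]:
  assumes "v \<in> V" "w \<in> V"
    and refl: "\<And>v. P v v"
    and commute: "\<And>v w. P w v \<Longrightarrow> P v w"
    and ascend: "\<And>v w. v \<in> V \<Longrightarrow> w \<in> V \<Longrightarrow> v \<noteq> w \<Longrightarrow> rank w \<le> rank v \<Longrightarrow> 0 < rank v \<Longrightarrow>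
      P (up v) w \<Longrightarrow> P v w"
  shows "P v w"
  using assms(1,2)
proof (induction "rank v + rank w" arbitrary: v w rule: less_induct)
  case less
  have ordered: "P a b"
    if "a \<in> V" "b \<in> V" "a \<noteq> b" "rank b \<le> rank a" "rank a + rank b = rank v + rank w" for a b
  proof -
    have "0 < rank a" using unique_root[of a b] that by fastforce
    then show ?thesis
      using ascend that less.hyps[of "up a" b] rank_up[of a] up_vertex[of a] by simp
  qed
  consider "v = w" | "v \<noteq> w" "rank w \<le> rank v" | "v \<noteq> w" "rank v \<le> rank w" by linarith
  then show ?case
  proof cases
    case 1
    then show ?thesis using refl by simp
  next
    case 2
    then show ?thesis using ordered less.prems by simp
  next
    case 3
    then show ?thesis using ordered[of w v] commute less.prems by simp
  qed
qed

lemma path_unique: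
  assumes "v \<in> V" "w \<in> V" "is_path edges v p w" "is_path edges v q w"
  shows "p = q"
proof -
  have "\<forall>p q. is_path edges v p w \<longrightarrow> is_path edges v q w \<longrightarrow> p = q"
    using assms(1,2)
  proof (induction rule: rank_pair_induct)
    case (refl v)
    then show ?case by (simp add: is_path_self_iff)
  next
    case (commute v w)
    then show ?case using is_path_rev rev_swap by metis
  next
    case (ascend v w)
    show ?case
    proof (intro allI impI)
      fix p q assume "is_path edges v p w" "is_path edges v q w"
      then obtain p' q' where "p = v # p'" "is_path edges (up v) p' w"
        "q = v # q'" "is_path edges (up v) q' w"
        using ascend.hyps path_ascends by metis
      then show "p = q" using ascend.IH by blast
    qed
  qed
  then show ?thesis using assms by blast
qed

lemma path_exists:
  assumes "v \<in> V" "w \<in> V"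
  shows "\<exists>p. is_path edges v p w \<and> (\<forall>t \<in> set p. t = v \<or> t = w \<or> rank t < max (rank v) (rank w))"
  using assms
proof (induction rule: rank_pair_induct)
  case (refl v)
  show ?case by (intro exI[of _ "[v]"]) (simp add: is_path_self_iff)
next
  case (commute v w)
  then obtain p where "is_path edges w p v"
    "\<forall>t \<in> set p. t = w \<or> t = v \<or> rank t < max (rank w) (rank v)" by blast
  then show ?case
    using is_path_rev[of edges w p v] by (intro exI[of _ "rev p"]) (auto simp: max.commute)
next
  case (ascend v w)
  then obtain p where p: "is_path edges (up v) p w"
    "\<forall>t \<in> set p. t = up v \<or> t = w \<or> rank t < max (rank (up v)) (rank w)" by blast
  have below: "t = w \<or> rank t < rank v" if "t \<in> set p" for t
    using p(2) that rank_up ascend.hyps by fastforce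
  obtain p' where p': "p = up v # p'" using p(1) by (cases p) (auto simp: is_path_def)
  have "v \<notin> set p" using below ascend.hyps by blast
  then have "is_path edges v (v # p) w"
    using p(1) edge_upI ascend.hyps unfolding p' by (simp add: is_path_Cons_iff)
  then show ?case using below ascend.hyps(4) by (intro exI[of _ "v # p"]) auto
qed

end

locale unique_path_graph =
  fixes V :: "'v set" and E :: "'v set set"
  assumes edge_vertex: "{v, w} \<in> E \<Longrightarrow> v \<in> V"
    and ex1_path: "v \<in> V \<Longrightarrow> w \<in> V \<Longrightarrow> \<exists>!p. is_path E v p w"
begin

definition path :: "'v \<Rightarrow> 'v \<Rightarrow> 'v list" where
  "path v w = (THE p. is_path E v p w)"

definition seg :: "'v \<Rightarrow> 'v \<Rightarrow> 'v set" where
  "seg v w = set (path v w)"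

lemma is_path_path: "v \<in> V \<Longrightarrow> w \<in> V \<Longrightarrow> is_path E v (path v w) w"
  unfolding path_def by (rule theI') (rule ex1_path)

lemma path_eqI: "is_path E v p w \<Longrightarrow> v \<in> V \<Longrightarrow> w \<in> V \<Longrightarrow> path v w = p"
  using is_path_path ex1_path by blast

lemma path_refl [simp]: "v \<in> V \<Longrightarrow> path v v = [v]"
  using is_path_path is_path_self_iff by metis

lemma path_rev: "v \<in> V \<Longrightarrow> w \<in> V \<Longrightarrow> path w v = rev (path v w)"
  by (intro path_eqI is_path_rev is_path_path)

lemma path_edge: "{v, w} \<in> E \<Longrightarrow> v \<noteq> w \<Longrightarrow> path v w = [v, w]"
  using edge_vertex[of v w] edge_vertex[of w v]
  by (intro path_eqI) (auto simp: is_path_def insert_commute)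

lemma is_path_vertices:
  assumes "is_path E v p w" "v \<in> V"
  shows "set p \<subseteq> V"
  using assms
proof (induction p arbitrary: v)
  case (Cons a p)
  show ?case
  proof (cases "v = w")
    case True
    then have "a # p = [v]" using Cons.prems(1) is_path_self_iff by metis
    then show ?thesis using Cons.prems(2) by simp
  next
    case False
    from is_path_cases[OF Cons.prems(1) this]
    obtain u q where "a # p = v # u # q" "{v, u} \<in> E" "is_path E u (u # q) w" by metis
    then show ?thesis
      using Cons.IH[of u] Cons.prems(2) edge_vertex[of u v] by (simp add: insert_commute)
  qed
qed simp

lemma seg_vertices: "v \<in> V \<Longrightarrow> w \<in> V \<Longrightarrow> seg v w \<subseteq> V"
  unfolding seg_def using is_path_path is_path_vertices by blast

lemma seg_commute: "v \<in> V \<Longrightarrow> w \<in> V \<Longrightarrow> seg v w = seg w v"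
  using path_rev[of v w] by (simp add: seg_def)

lemma start_in_seg: "v \<in> V \<Longrightarrow> w \<in> V \<Longrightarrow> v \<in> seg v w"
  and end_in_seg: "v \<in> V \<Longrightarrow> w \<in> V \<Longrightarrow> w \<in> seg v w"
  using is_path_path[of v w] hd_in_set last_in_set by (fastforce simp: is_path_def seg_def)+

lemma path_split:
  assumes "v \<in> V" "w \<in> V" "m \<in> seg v w"
  obtains p q where "path v w = p @ m # q" "path v m = p @ [m]" "path m w = m # q"
    "set p \<inter> set q = {}" "m \<notin> set p" "m \<notin> set q"
proof -
  obtain p q where pq: "path v w = p @ m # q" using assms(3) by (metis seg_def split_list)
  have m: "m \<in> V" using seg_vertices assms by blast
  have "is_path E v (p @ m # q) w" using is_path_path[OF assms(1,2)] pq by simp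
  then have "is_path E v (p @ [m]) m" "is_path E m (m # q) w" "set p \<inter> set q = {}"
      "m \<notin> set p" "m \<notin> set q"
    unfolding is_path_append_iff[of E v p m q w] by (auto simp: is_path_def)
  then show thesis using that pq path_eqI m assms by blast
qed

lemma path_concat:
  assumes "v \<in> V" "m \<in> V" "w \<in> V" "seg v m \<inter> seg m w \<subseteq> {m}"
  shows "m \<in> seg v w"
proof -
  have vm: "is_path E v (path v m) m" and mw: "is_path E m (path m w) w"
    using assms is_path_path by auto
  obtain q where q: "path m w = m # q" using mw by (cases "path m w") (auto simp: is_path_def)
  obtain p where p: "path v m = p @ [m]"
    using vm by (metis append_butlast_last_id is_path_def)
  have "set p \<inter> set q \<subseteq> {m}" using assms(4) p q by (auto simp: seg_def)
  moreover have "m \<notin> set p" using vm p by (simp add: is_path_def)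
  ultimately have "set p \<inter> set q = {}" by blast
  then have "is_path E v (p @ m # q) w"
    using vm mw p q by (simp add: is_path_append_iff[of E v p m q w])
  then show ?thesis using path_eqI assms by (simp add: seg_def)
qed

lemma seg_split:
  assumes "v \<in> V" "w \<in> V" "m \<in> seg v w"
  shows "seg v w = seg v m \<union> seg m w" "seg v m \<inter> seg m w = {m}"
proof -
  obtain p q where "path v w = p @ m # q" "path v m = p @ [m]" "path m w = m # q"
    "set p \<inter> set q = {}"
    "m \<notin> set p" "m \<notin> set q"
    using path_split[OF assms] .
  then show "seg v w = seg v m \<union> seg m w" "seg v m \<inter> seg m w = {m}"
    by (auto simp: seg_def)
qed

definition seg_closed :: "'v set \<Rightarrow> bool" where
  "seg_closed A \<longleftrightarrow> A \<subseteq> V \<and> (\<forall>a \<in> A. \<forall>b \<in> A. seg a b \<subseteq> A)"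

lemma seg_closed_seg:
  assumes "v \<in> V" "w \<in> V"
  shows "seg_closed (seg v w)"
proof -
  have "seg a b \<subseteq> seg v w" if "a \<in> seg v w" "b \<in> seg v w" for a b
  proof -
    have V: "a \<in> V" "b \<in> V" using that seg_vertices assms by auto
    note a = seg_split(1)[OF assms that(1)]
    from that(2) a consider "b \<in> seg v a" | "b \<in> seg a w" by blast
    then show ?thesis
    proof cases
      case 1
      then show ?thesis using seg_split(1)[of v a b] a seg_commute V assms by blast
    next
      case 2
      then show ?thesis using seg_split(1)[of a w b] a V assms by blast
    qed
  qed
  then show ?thesis using seg_vertices assms by (auto simp: seg_closed_def)
qed

lemma length_path_tail:
  assumes "v \<in> V" "w \<in> V" "m \<in> seg v w"
  shows "length (path m w) \<le> length (path v w)" "m \<noteq> v \<Longrightarrow> length (path m w) < length (path v w)"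
proof -
  obtain p q where split: "path v w = p @ m # q" "path v m = p @ [m]" "path m w = m # q"
    using path_split[OF assms] by metis
  then show "length (path m w) \<le> length (path v w)" by simp
  have "m \<in> V" using assms seg_vertices by blast
  then have "m \<noteq> v \<Longrightarrow> p \<noteq> []" using is_path_path[of v m] assms(1) split by (auto simp: is_path_def)
  then show "m \<noteq> v \<Longrightarrow> length (path m w) < length (path v w)" using split by simp
qed

definition gates :: "'v set \<Rightarrow> 'v set \<Rightarrow> 'v \<Rightarrow> 'v \<Rightarrow> bool" where
  "gates A B v w \<longleftrightarrow> v \<in> A \<and> w \<in> B \<and> seg v w \<inter> A = {v} \<and> seg v w \<inter> B = {w}"

lemma length_path_commute: "v \<in> V \<Longrightarrow> w \<in> V \<Longrightarrow> length (path v w) = length (path w v)"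
  using path_rev[of v w] by simp

lemma gates_exist:
  assumes "A \<subseteq> V" "B \<subseteq> V" "A \<noteq> {}" "B \<noteq> {}"
  obtains v w where "gates A B v w"
proof -
  have "\<exists>z. z \<in> A \<times> B" using assms(3,4) by auto
  then obtain z where z: "z \<in> A \<times> B"
    "\<forall>z'. z' \<in> A \<times> B \<longrightarrow> length (path (fst z) (snd z)) \<le> length (path (fst z') (snd z'))"
    using ex_has_least_nat[of "\<lambda>z. z \<in> A \<times> B" _ "\<lambda>z. length (path (fst z) (snd z))"] by blast
  define v w where "v = fst z" and "w = snd z"
  have vw: "v \<in> A" "w \<in> B" using z(1) by (auto simp: v_def w_def)
  have least: "length (path v w) \<le> length (path a b)" if "a \<in> A" "b \<in> B" for a b
    using z(2) that by (auto simp: v_def w_def)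
  have V: "v \<in> V" "w \<in> V" using vw assms(1,2) by auto
  have "m = v" if "m \<in> seg v w" "m \<in> A" for m
    using length_path_tail(2)[OF V that(1)] least[OF that(2) vw(2)] by linarith
  moreover have "m = w" if "m \<in> seg v w" "m \<in> B" for m
  proof -
    have "m \<in> V" "m \<in> seg w v" using that seg_commute[OF V] assms(2) by auto
    then show ?thesis
      using length_path_tail(2)[OF V(2,1), of m] least[OF vw(1) that(2)]
        length_path_commute[OF V] length_path_commute[OF V(1), of m] by linarith
  qed
  ultimately have "gates A B v w"
    unfolding gates_def using vw start_in_seg[OF V] end_in_seg[OF V] by blast
  then show thesis by (rule that)
qed

lemma gates_on_path:
  assumes "seg_closed A" "seg_closed B" "A \<inter> B = {}" "gates A B v0 w0" "v \<in> A" "w \<in> B"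
  shows "v0 \<in> seg v w" "w0 \<in> seg v0 w"
proof -
  have V: "v \<in> V" "w \<in> V" "v0 \<in> V" "w0 \<in> V"
    using assms by (auto simp: seg_closed_def gates_def)
  have A: "seg v v0 \<subseteq> A" and B: "seg w0 w \<subseteq> B"
    using assms by (auto simp: seg_closed_def gates_def)
  show "w0 \<in> seg v0 w"
    by (rule path_concat) (use V B assms(4) in \<open>auto simp: gates_def\<close>)
  then have "seg v0 w = seg v0 w0 \<union> seg w0 w" using seg_split(1) V by blast
  then have "seg v v0 \<inter> seg v0 w \<subseteq> {v0}"
    using A B assms(3,4) by (auto simp: gates_def)
  then show "v0 \<in> seg v w" using path_concat V by blast
qed

lemma gates_unique_shortest:
  assumes "seg_closed A" "seg_closed B" "A \<inter> B = {}" "gates A B v0 w0" "v \<in> A" "w \<in> B"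
  shows "length (path v0 w0) \<le> length (path v w)"
    "length (path v w) \<le> length (path v0 w0) \<Longrightarrow> v = v0 \<and> w = w0"
proof -
  have V: "v \<in> V" "w \<in> V" "v0 \<in> V" "w0 \<in> V"
    using assms by (auto simp: seg_closed_def gates_def)
  note on_path = gates_on_path[OF assms]
  have w0: "w0 \<in> seg w v0" using on_path(2) seg_commute V by blast
  have "length (path v0 w) \<le> length (path v w)" "v0 \<noteq> v \<Longrightarrow> length (path v0 w) < length (path v w)"
    using length_path_tail[OF V(1,2) on_path(1)] by auto
  moreover have "length (path v0 w0) \<le> length (path v0 w)"
    "w0 \<noteq> w \<Longrightarrow> length (path v0 w0) < length (path v0 w)"
    using length_path_tail[OF V(2,3) w0] length_path_commute V by metis+
  ultimately show "length (path v0 w0) \<le> length (path v w)"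
    "length (path v w) \<le> length (path v0 w0) \<Longrightarrow> v = v0 \<and> w = w0"
    by fastforce+
qed

lemma interior_vertex_two_edges:
  assumes "v \<in> V" "w \<in> V" "m \<in> seg v w" "m \<noteq> v" "m \<noteq> w"
  obtains s t where "{m, s} \<in> E" "{m, t} \<in> E" "s \<noteq> t"
proof -
  obtain p q where pq: "path v w = p @ m # q" "path v m = p @ [m]" "path m w = m # q"
    "set p \<inter> set q = {}"
    using path_split[OF assms(1-3)] by metis
  have m: "m \<in> V" using seg_vertices assms by blast
  have "p \<noteq> []" "q \<noteq> []"
    using is_path_path[of v m] is_path_path[of m w] pq m assms by (auto simp: is_path_def)
  then obtain p' s t q' where neighbours: "p = p' @ [s]" "q = t # q'"
    by (metis append_butlast_last_id neq_Nil_conv)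
  have "successively (\<lambda>a b. {a, b} \<in> E) (p' @ [s, m, t] @ q')"
    using is_path_path[OF assms(1,2)] pq(1) neighbours by (simp add: is_path_def)
  then have "{s, m} \<in> E" "{m, t} \<in> E" by (auto simp: successively_append_iff)
  moreover have "s \<noteq> t" using pq(4) neighbours by auto
  ultimately show thesis using that by (metis insert_commute)
qed

end

sublocale parent_tree \<subseteq> unique_path_graph V edges
proof
  show "v \<in> V" if "{v, w} \<in> edges" for v w
    using that up_vertex by (cases rule: edge_cases) auto
  show "\<exists>!p. is_path edges v p w" if "v \<in> V" "w \<in> V" for v w
    using path_exists[OF that] path_unique[OF that] by (intro ex_ex1I) blast+
qed

definition path_length :: "('v \<Rightarrow> 'v \<Rightarrow> real) \<Rightarrow> 'v list \<Rightarrow> real" where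
  "path_length len p = sum_list (map2 len p (tl p))"

lemma path_length_simps [simp]:
  "path_length len [] = 0" "path_length len [v] = 0"
  "path_length len (v # w # p) = len v w + path_length len (w # p)"
  by (simp_all add: path_length_def)

lemma path_length_append:
  "path_length len (p @ m # q) = path_length len (p @ [m]) + path_length len (m # q)"
  by (induction p rule: induct_list012) simp_all

lemma path_length_rev:
  assumes "\<And>v w. len v w = len w v"
  shows "path_length len (rev p) = path_length len p"
proof (induction p rule: induct_list012)
  case (3 v w p)
  then show ?case using path_length_append[of len "rev p" w "[v]"] assms[of v w] by simp
qed simp_all

lemma path_length_pos:
  assumes "successively (\<lambda>v w. 0 < len v w) p" "2 \<le> length p"
  shows "0 < path_length len p"
  using assms
proof (induction p rule: induct_list012)
  case (3 v w p)
  then show ?case by (cases p) auto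
qed simp_all

lemma path_length_cong:
  assumes "successively (\<lambda>v w. len v w = len' v w) p"
  shows "path_length len p = path_length len' p"
  using assms by (induction p rule: induct_list012) simp_all

locale metric_tree = unique_path_graph V E for V :: "'v set" and E :: "'v set set" +
  fixes edge_len :: "'v \<Rightarrow> 'v \<Rightarrow> real"
  assumes edge_len_commute: "edge_len v w = edge_len w v"
    and edge_len_pos: "{v, w} \<in> E \<Longrightarrow> 0 < edge_len v w"
begin

definition path_metric :: "'v \<Rightarrow> 'v \<Rightarrow> real" where
  "path_metric v w = path_length edge_len (path v w)"

lemma path_metric_refl [simp]: "v \<in> V \<Longrightarrow> path_metric v v = 0"
  by (simp add: path_metric_def)

lemma path_metric_edge: "{v, w} \<in> E \<Longrightarrow> v \<noteq> w \<Longrightarrow> path_metric v w = edge_len v w"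
  by (simp add: path_metric_def path_edge)

lemma path_metric_commute: "v \<in> V \<Longrightarrow> w \<in> V \<Longrightarrow> path_metric v w = path_metric w v"
  using path_rev[of v w] path_length_rev[of edge_len "path v w", OF edge_len_commute]
  by (simp add: path_metric_def)

lemma path_metric_pos:
  assumes "v \<in> V" "w \<in> V" "v \<noteq> w"
  shows "0 < path_metric v w"
proof -
  have path: "is_path E v (path v w) w" using is_path_path assms by blast
  then have "2 \<le> length (path v w)" using assms(3) by (rule is_path_cases) simp
  moreover have "successively (\<lambda>a b. {a, b} \<in> E) (path v w)" using path by (simp add: is_path_def)
  then have "successively (\<lambda>a b. 0 < edge_len a b) (path v w)"
    by (rule successively_mono) (rule edge_len_pos)
  ultimately show ?thesis unfolding path_metric_def by (rule path_length_pos[rotated])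
qed

lemma path_metric_nonneg: "v \<in> V \<Longrightarrow> w \<in> V \<Longrightarrow> 0 \<le> path_metric v w"
  using path_metric_pos[of v w] by (cases "v = w") auto

lemma path_metric_split:
  assumes "v \<in> V" "w \<in> V" "m \<in> seg v w"
  shows "path_metric v w = path_metric v m + path_metric m w"
proof -
  obtain p q where "path v w = p @ m # q" "path v m = p @ [m]" "path m w = m # q"
    using path_split[OF assms] by metis
  then show ?thesis by (simp add: path_metric_def path_length_append[of _ p m q])
qed

lemma path_metric_triangle:
  assumes "u \<in> V" "v \<in> V" "w \<in> V"
  shows "path_metric u w \<le> path_metric u v + path_metric v w"
proof (cases "v \<in> seg u w")
  case True
  then show ?thesis using path_metric_split assms by simp
next
  case False
  have closed: "seg_closed (seg u w)" "seg_closed {v}"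
    using seg_closed_seg assms by (auto simp: seg_closed_def seg_def)
  obtain m where m: "gates (seg u w) {v} m v"
    using gates_exist[of "seg u w" "{v}"] closed start_in_seg[of u w] assms
    unfolding seg_closed_def gates_def by (metis empty_iff insert_not_empty singletonD)
  have "m \<in> seg u w" using m by (simp add: gates_def)
  moreover have "m \<in> V" using \<open>m \<in> seg u w\<close> seg_vertices assms by blast
  moreover have "m \<in> seg u v" "m \<in> seg w v"
    using gates_on_path(1)[OF closed _ m] False start_in_seg end_in_seg assms by auto
  ultimately show ?thesis
    using path_metric_split[of u w m] path_metric_split[of u v m] path_metric_split[of w v m]
      path_metric_nonneg[of m v] path_metric_commute[of w v] path_metric_commute[of w m] assms
    by simp
qed

lemma path_metric_gates:
  assumes "seg_closed A" "seg_closed B" "A \<inter> B = {}" "gates A B v0 w0" "v \<in> A" "w \<in> B"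
  shows "path_metric v w = path_metric v v0 + path_metric v0 w0 + path_metric w0 w"
proof -
  have V: "v \<in> V" "w \<in> V" "v0 \<in> V" using assms by (auto simp: seg_closed_def gates_def)
  show ?thesis
    using path_metric_split[OF V(1,2) gates_on_path(1)[OF assms]]
      path_metric_split[OF V(3,2) gates_on_path(2)[OF assms]] by simp
qed

lemma four_point_disjoint:
  assumes "a \<in> V" "b \<in> V" "c \<in> V" "e \<in> V" "seg a b \<inter> seg c e = {}" "gates (seg a b) (seg c e) v w"
  shows "path_metric a c + path_metric a e + path_metric b c + path_metric b e =
    2 * path_metric a b + 2 * path_metric c e + 4 * path_metric v w"
proof -
  have vw: "v \<in> seg a b" "w \<in> seg c e" using assms(6) by (auto simp: gates_def)
  have V: "v \<in> V" "w \<in> V" using vw seg_vertices assms by auto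
  have via_gates: "path_metric x y = path_metric x v + path_metric v w + path_metric w y"
    if "x \<in> seg a b" "y \<in> seg c e" for x y
    using path_metric_gates[OF seg_closed_seg seg_closed_seg assms(5,6) that] assms(1-4) by simp
  have ends: "a \<in> seg a b" "b \<in> seg a b" "c \<in> seg c e" "e \<in> seg c e"
    using start_in_seg end_in_seg assms(1-4) by auto
  show ?thesis
    using via_gates[OF ends(1,3)] via_gates[OF ends(1,4)] via_gates[OF ends(2,3)] via_gates[OF ends(2,4)]
      path_metric_split[of a b v] path_metric_split[of c e w] vw assms(1-4)
      path_metric_commute[OF V(1), of b] path_metric_commute[OF V(2), of c] by simp
qed

lemma four_point_meet:
  assumes "a \<in> V" "b \<in> V" "c \<in> V" "e \<in> V" "seg a b \<inter> seg c e \<noteq> {}"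
  shows "path_metric a c + path_metric a e + path_metric b c + path_metric b e \<le>
    2 * path_metric a b + 2 * path_metric c e"
proof -
  obtain m where m: "m \<in> seg a b" "m \<in> seg c e" using assms by blast
  have "m \<in> V" using m seg_vertices assms by blast
  then show ?thesis
    using path_metric_split[of a b m] path_metric_split[of c e m] m assms
      path_metric_triangle[of a m c] path_metric_triangle[of a m e]
      path_metric_triangle[of b m c] path_metric_triangle[of b m e]
      path_metric_commute[of m c] path_metric_commute[of m b] by simp
qed

end

section \<open>Clusters\<close>

locale root_set = valued_field ord for ord :: "'a::field \<Rightarrow> ereal" +
  fixes R :: "'a set"
  assumes finite_roots: "finite R" and roots_nonempty: "R \<noteq> {}"
begin

abbreviation "\<C> \<equiv> clusters ord R"
abbreviation "par \<equiv> parent ord R"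

definition disc :: "'a \<Rightarrow> ereal \<Rightarrow> 'a set" where
  "disc a r = {b \<in> R. r \<le> ord (b - a)}"

lemma disc_antimono: "r \<le> r' \<Longrightarrow> disc a r' \<subseteq> disc a r"
  by (auto simp: disc_def)

lemma disc_recenter:
  assumes "b \<in> disc a r"
  shows "disc b r = disc a r"
proof -
  have "r \<le> ord (b - a)" "r \<le> ord (a - b)" using assms ord_minus_commute by (auto simp: disc_def)
  then show ?thesis using ord_diff_trans unfolding disc_def by blast
qed

lemma disc_cluster: "a \<in> R \<Longrightarrow> disc a (ereal r) \<in> \<C>"
  unfolding clusters_def disc_def
  by (intro CollectI conjI exI[of _ a] exI[of _ r]) (auto intro: exI[of _ a])

lemma cluster_disc:
  assumes "s \<in> \<C>" "a \<in> s"
  obtains r where "s = disc a (ereal r)"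
proof -
  obtain z r where "s = disc z (ereal r)"
    using assms(1) by (auto simp: clusters_def disc_def)
  then show thesis using that disc_recenter assms(2) by metis
qed

lemma cluster_subset: "s \<in> \<C> \<Longrightarrow> s \<subseteq> R"
  and cluster_nonempty: "s \<in> \<C> \<Longrightarrow> s \<noteq> {}"
  by (auto simp: clusters_def)

lemma finite_cluster: "s \<in> \<C> \<Longrightarrow> finite s"
  using cluster_subset finite_roots finite_subset by blast

lemma finite_clusters: "finite \<C>"
  by (rule finite_subset[of _ "Pow R"]) (use cluster_subset finite_roots in auto)

lemma roots_cluster: "R \<in> \<C>"
proof -
  obtain a where a: "a \<in> R" using roots_nonempty by blast
  define r where "r = Min ((\<lambda>b. rord (b - a)) ` R)"
  have "ereal r \<le> ord (b - a)" if "b \<in> R" for b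
  proof (cases "b = a")
    case False
    have "r \<le> rord (b - a)" unfolding r_def using that finite_roots by simp
    then show ?thesis using False by (simp add: ord_eq_rord)
  qed simp
  then have "disc a (ereal r) = R" by (auto simp: disc_def)
  then show ?thesis using disc_cluster[OF a, of r] by simp
qed

lemma singleton_cluster:
  assumes "a \<in> R"
  shows "{a} \<in> \<C>"
proof -
  define r where "r = Max ((\<lambda>b. rord (b - a)) ` R) + 1"
  have "\<not> ereal r \<le> ord (b - a)" if "b \<in> R" "b \<noteq> a" for b
  proof -
    have "rord (b - a) \<le> Max ((\<lambda>b. rord (b - a)) ` R)" using that(1) finite_roots by simp
    then show ?thesis using that(2) by (simp add: ord_eq_rord r_def)
  qed
  then have "disc a (ereal r) = {a}" using assms by (auto simp: disc_def)
  then show ?thesis using disc_cluster[OF assms, of r] by simp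
qed

lemma depth_le:
  assumes "finite s" "a \<in> s" "b \<in> s"
  shows "depth ord s \<le> ord (a - b)"
  unfolding depth_def by (rule Min_le) (use assms in \<open>auto intro: finite_image_set2\<close>)

lemma depth_attained:
  assumes "finite s" "s \<noteq> {}"
  obtains a b where "a \<in> s" "b \<in> s" "depth ord s = ord (a - b)"
proof -
  have "depth ord s \<in> {ord (r - r') |r r'. r \<in> s \<and> r' \<in> s}"
    unfolding depth_def by (rule Min_in) (use assms in \<open>auto intro: finite_image_set2\<close>)
  then show thesis using that by blast
qed

lemma cluster_eq_disc:
  assumes "s \<in> \<C>" "a \<in> s"
  shows "s = disc a (depth ord s)"
proof
  note fin = finite_cluster[OF assms(1)]
  show "s \<subseteq> disc a (depth ord s)"
    using cluster_subset[OF assms(1)] depth_le[OF fin] assms(2) by (auto simp: disc_def)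
  obtain b c where bc: "b \<in> s" "c \<in> s" "depth ord s = ord (b - c)"
    using depth_attained[OF fin cluster_nonempty[OF assms(1)]] .
  obtain r where r: "s = disc c (ereal r)" using cluster_disc[OF assms(1) bc(2)] .
  have "ereal r \<le> depth ord s" using bc(1,3) unfolding r by (simp add: disc_def)
  then have "disc a (depth ord s) \<subseteq> disc a (ereal r)" by (rule disc_antimono)
  also have "disc a (ereal r) = s" using disc_recenter assms(2) unfolding r by blast
  finally show "disc a (depth ord s) \<subseteq> s" .
qed

lemma clusters_laminar:
  assumes "s \<in> \<C>" "t \<in> \<C>" "s \<inter> t \<noteq> {}"
  shows "s \<subseteq> t \<or> t \<subseteq> s"
proof -
  obtain a where "a \<in> s" "a \<in> t" using assms(3) by blast
  then have "s = disc a (depth ord s)" "t = disc a (depth ord t)"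
    using cluster_eq_disc assms(1,2) by auto
  then show ?thesis using disc_antimono linear by metis
qed

lemma depth_strict_antimono:
  assumes "s \<in> \<C>" "t \<in> \<C>" "s \<subset> t"
  shows "depth ord t < depth ord s"
proof (rule ccontr)
  assume "\<not> depth ord t < depth ord s"
  moreover obtain a where "a \<in> s" "a \<in> t" using cluster_nonempty assms by blast
  ultimately have "t \<subseteq> s"
    using cluster_eq_disc[OF assms(1)] cluster_eq_disc[OF assms(2)] disc_antimono not_less by metis
  then show False using assms(3) by blast
qed

definition pair_cluster :: "'a \<Rightarrow> 'a \<Rightarrow> 'a set" where
  "pair_cluster a b = disc a (ord (a - b))"

lemma
  assumes "a \<in> R" "b \<in> R" "a \<noteq> b"
  shows pair_cluster: "pair_cluster a b \<in> \<C>"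
    and left_in_pair_cluster: "a \<in> pair_cluster a b"
    and right_in_pair_cluster: "b \<in> pair_cluster a b"
  using assms disc_cluster[of a "rord (a - b)"] ord_minus_commute[of a b]
  by (auto simp: pair_cluster_def disc_def ord_eq_rord)

lemma pair_cluster_least:
  assumes "t \<in> \<C>" "a \<in> t" "b \<in> t"
  shows "pair_cluster a b \<subseteq> t"
proof -
  have "depth ord t \<le> ord (a - b)" using depth_le finite_cluster assms by blast
  then show ?thesis
    unfolding pair_cluster_def by (subst cluster_eq_disc[OF assms(1,2)]) (rule disc_antimono)
qed

lemma depth_pair_cluster:
  assumes "a \<in> R" "b \<in> R" "a \<noteq> b"
  shows "depth ord (pair_cluster a b) = ord (a - b)"
proof (rule antisym)
  note pair = pair_cluster[OF assms] left_in_pair_cluster[OF assms] right_in_pair_cluster[OF assms]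
  note fin = finite_cluster[OF pair(1)]
  show "depth ord (pair_cluster a b) \<le> ord (a - b)" using depth_le fin pair by blast
  obtain c e where ce: "c \<in> pair_cluster a b" "e \<in> pair_cluster a b"
    "depth ord (pair_cluster a b) = ord (c - e)"
    using depth_attained fin cluster_nonempty[OF pair(1)] .
  then have "ord (a - b) \<le> ord (c - a)" "ord (a - b) \<le> ord (a - e)"
    using ord_minus_commute by (auto simp: pair_cluster_def disc_def)
  then show "ord (a - b) \<le> depth ord (pair_cluster a b)" unfolding ce(3) by (rule ord_diff_trans)
qed

lemma proper_cluster_iff: "s \<in> \<C> \<Longrightarrow> proper s \<longleftrightarrow> (\<exists>a\<in>s. \<exists>b\<in>s. a \<noteq> b)"
  using finite_cluster[of s] card_le_Suc0_iff_eq[of s] by (auto simp: not_le[symmetric])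

lemma proper_mono: "proper s \<Longrightarrow> s \<subseteq> t \<Longrightarrow> t \<in> \<C> \<Longrightarrow> proper t"
  using card_mono[of t s] finite_cluster by fastforce

lemma not_proper_cluster_singleton:
  assumes "s \<in> \<C>" "\<not> proper s"
  obtains a where "s = {a}"
  using assms cluster_nonempty[of s] proper_cluster_iff[of s] by blast

text \<open>
  A singleton has infinite depth, of which \<open>real_of_ereal\<close> would make 0. Any common finite height
  above all other depths will do instead, as it cancels from the order of \<^const>\<open>cross_value\<close>.
\<close>

definition leaf_height :: real where
  "leaf_height = Max ((\<lambda>s. real_of_ereal (depth ord s)) ` \<C>) + 1"

definition height :: "'a set \<Rightarrow> real" where
  "height s = (if proper s then real_of_ereal (depth ord s) else leaf_height)"

lemma height_singleton [simp]: "height {a} = leaf_height"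
  by (simp add: height_def)

lemma depth_eq_height:
  assumes "s \<in> \<C>" "proper s"
  shows "depth ord s = ereal (height s)"
proof -
  note fin = finite_cluster[OF assms(1)]
  obtain a b where "a \<in> s" "b \<in> s" "a \<noteq> b" using proper_cluster_iff assms by blast
  then have "depth ord s \<le> ereal (rord (a - b))"
    using depth_le[OF fin, of a b] ord_eq_rord[of "a - b"] by simp
  then have "depth ord s \<noteq> \<infinity>" by auto
  moreover have "depth ord s \<noteq> -\<infinity>"
    using depth_attained[OF fin cluster_nonempty[OF assms(1)]] ord_neq_MInfty by metis
  ultimately show ?thesis using assms(2) by (cases "depth ord s") (simp_all add: height_def)
qed

lemma height_pair_cluster:
  assumes "a \<in> R" "b \<in> R" "a \<noteq> b"
  shows "height (pair_cluster a b) = rord (a - b)"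
proof -
  have "proper (pair_cluster a b)"
    using proper_cluster_iff[OF pair_cluster] left_in_pair_cluster right_in_pair_cluster assms
    by blast
  then show ?thesis by (simp add: height_def depth_pair_cluster[OF assms] rord_def)
qed

lemma height_strict_antimono:
  assumes "s \<in> \<C>" "t \<in> \<C>" "s \<subset> t"
  shows "height t < height s"
proof -
  have t: "proper t"
    using psubset_card_mono[OF finite_cluster assms(3)] card_gt_0_iff[of s] finite_cluster
      cluster_nonempty assms(1,2) by fastforce
  show ?thesis
  proof (cases "proper s")
    case True
    then show ?thesis
      using depth_strict_antimono[OF assms] depth_eq_height assms(1,2) t by simp
  next
    case False
    have "height t \<le> Max ((\<lambda>s. real_of_ereal (depth ord s)) ` \<C>)"
      using t assms(2) finite_clusters by (simp add: height_def)
    then show ?thesis using False by (simp add: height_def leaf_height_def)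
  qed
qed

lemma
  assumes "s \<in> \<C>" "s \<noteq> R"
  shows parent_cluster: "par s \<in> \<C>" and psubset_parent: "s \<subset> par s"
    and parent_least: "\<And>t. t \<in> \<C> \<Longrightarrow> s \<subset> t \<Longrightarrow> par s \<subseteq> t"
proof -
  let ?T = "{t \<in> \<C>. s \<subset> t}"
  have "finite ?T" "R \<in> ?T" using finite_clusters roots_cluster assms cluster_subset by auto
  then obtain t where t: "t \<in> ?T" "\<forall>u\<in>?T. u \<subseteq> t \<longrightarrow> t = u"
    using finite_has_minimal[of ?T] by blast
  have least: "t \<subseteq> u" if "u \<in> ?T" for u
  proof -
    have "t \<inter> u \<noteq> {}" using t(1) that cluster_nonempty[OF assms(1)] by blast
    then have "t \<subseteq> u \<or> u \<subseteq> t" using clusters_laminar t(1) that by blast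
    then show ?thesis using t(2) that by blast
  qed
  have "par s = t" unfolding parent_def by (rule Least_equality) (use t(1) least in auto)
  then show "par s \<in> \<C>" "s \<subset> par s" "\<And>t. t \<in> \<C> \<Longrightarrow> s \<subset> t \<Longrightarrow> par s \<subseteq> t"
    using t(1) least by auto
qed

lemma siblings_disjoint:
  assumes "s \<in> \<C>" "t \<in> \<C>" "s \<noteq> R" "t \<noteq> R" "par s = par t" "s \<noteq> t"
  shows "s \<inter> t = {}"
proof (rule ccontr)
  assume "s \<inter> t \<noteq> {}"
  then consider "s \<subset> t" | "t \<subset> s" using clusters_laminar assms by blast
  then show False
    using parent_least[OF assms(1,3,2)] psubset_parent[OF assms(1,3)]
      parent_least[OF assms(2,4,1)] psubset_parent[OF assms(2,4)] assms(5) by cases auto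
qed

lemma height_parent_less: "s \<in> \<C> \<Longrightarrow> s \<noteq> R \<Longrightarrow> height (par s) < height s"
  by (rule height_strict_antimono[OF _ parent_cluster psubset_parent])

lemma rel_depth_eq:
  assumes "s \<in> \<C>" "s \<noteq> R" "proper s"
  shows "rel_depth ord R s = height s - height (par s)"
proof -
  have "proper (par s)"
    using proper_mono[OF assms(3)] psubset_parent[OF assms(1,2)] parent_cluster[OF assms(1,2)]
    by blast
  then show ?thesis
    unfolding rel_depth_def using depth_eq_height parent_cluster assms by simp
qed

section \<open>The stable model tree\<close>

abbreviation "V \<equiv> tree_verts ord R"
abbreviation "E \<equiv> tree_edges ord R"

lemma vertex_cluster: "t \<in> V \<Longrightarrow> t \<in> \<C>"
  by (auto simp: tree_verts_def split: if_splits)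

lemma cluster_vertex: "t \<in> \<C> \<Longrightarrow> t \<noteq> R \<Longrightarrow> t \<in> V"
  by (auto simp: tree_verts_def)

lemma finite_vertices: "finite V"
  by (rule finite_subset[OF _ finite_clusters]) (use vertex_cluster in blast)

lemma top_splitD:
  assumes "top_split ord R s t"
  shows "s \<in> \<C>" "s \<noteq> R" "par s = R" "t \<in> \<C>" "t \<noteq> R" "par t = R"
    "s \<inter> t = {}" "s \<union> t = R" "R \<notin> V"
proof -
  show "R \<notin> V" unfolding tree_verts_def using assms by (metis Diff_iff singletonI)
qed (use assms in \<open>simp_all add: top_split_def top_children_def\<close>)

lemma top_split_commute: "top_split ord R s t \<longleftrightarrow> top_split ord R t s"
  by (auto simp: top_split_def)

lemma root_not_vertexE:
  assumes "R \<notin> V" "a \<in> R"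
  obtains s t where "top_split ord R s t" "a \<in> s"
proof -
  obtain s t where st: "top_split ord R s t"
    using assms(1) roots_cluster by (auto simp: tree_verts_def split: if_splits)
  then have "a \<in> s \<or> a \<in> t" using top_splitD(8) assms(2) by blast
  then show thesis using that st top_split_commute by blast
qed

lemma top_split_children:
  assumes "top_split ord R s1 s2" "s \<in> \<C>" "s \<noteq> R" "par s = R"
  shows "s = s1 \<or> s = s2"
proof (rule ccontr)
  note split = top_splitD[OF assms(1)]
  assume "\<not> (s = s1 \<or> s = s2)"
  then have "s \<inter> s1 = {}" "s \<inter> s2 = {}"
    using siblings_disjoint[OF assms(2)] assms(3,4) split by auto
  then show False
    using cluster_nonempty[OF assms(2)] cluster_subset[OF assms(2)] split(8) by blast
qed

definition child_edge :: "'a set \<Rightarrow> 'a set \<Rightarrow> bool" where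
  "child_edge s t \<longleftrightarrow> s \<in> \<C> \<and> s \<noteq> R \<and> par s = t \<and> t \<in> V"

lemma edge_iff: "{s, t} \<in> E \<longleftrightarrow> child_edge s t \<or> child_edge t s \<or> top_split ord R s t"
  unfolding tree_edges_def child_edge_def using top_split_commute by (auto simp: doubleton_eq_iff)

lemma child_edge_not_split: "child_edge s t \<Longrightarrow> \<not> top_split ord R s t"
  using top_splitD(3,5)[of s t] by (auto simp: child_edge_def)

lemma child_edge_psubset: "child_edge s t \<Longrightarrow> s \<subset> t"
  using psubset_parent by (auto simp: child_edge_def)

lemma card_complement_less: "s \<subset> t \<Longrightarrow> t \<subseteq> R \<Longrightarrow> card (R - t) < card (R - s)"
  by (rule psubset_card_mono) (use finite_roots in auto)

lemma card_complement_pos_iff: "s \<subseteq> R \<Longrightarrow> 0 < card (R - s) \<longleftrightarrow> s \<noteq> R"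
  using finite_roots by (auto simp: card_gt_0_iff)

lemma unique_path_with_root:
  assumes "R \<in> V" "v \<in> V" "w \<in> V"
  shows "\<exists>!p. is_path E v p w"
proof -
  have V: "V = \<C>" using assms(1) cluster_vertex vertex_cluster by blast
  have root_iff: "0 < card (R - s) \<longleftrightarrow> s \<noteq> R" if "s \<in> \<C>" for s
    by (rule card_complement_pos_iff[OF cluster_subset[OF that]])
  interpret parent_tree \<C> par "\<lambda>s. card (R - s)"
  proof
    fix s assume "s \<in> \<C>" "0 < card (R - s)"
    then have "s \<in> \<C>" "s \<noteq> R" using root_iff[of s] by simp_all
    then show "par s \<in> \<C>" "card (R - par s) < card (R - s)"
      using parent_cluster card_complement_less[OF psubset_parent cluster_subset[OF parent_cluster]]
      by simp_all
  next
    fix s t assume "s \<in> \<C>" "t \<in> \<C>" "card (R - s) = 0" "card (R - t) = 0"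
    then show "s = t" using root_iff[of s] root_iff[of t] by simp
  qed
  have "{s \<in> \<C>. 0 < card (R - s)} = {s \<in> \<C>. s \<noteq> R \<and> par s \<in> V}"
    using root_iff parent_cluster unfolding V by auto
  moreover have "{{s, t} |s t. top_split ord R s t} = {}" using top_splitD(9) assms(1) by blast
  ultimately have "edges = E"
    unfolding edges_def tree_edges_def by (simp add: setcompr_eq_image)
  then show ?thesis using ex1_path assms(2,3) V by simp
qed

lemma top_split_unique:
  assumes "top_split ord R s1 s2"
  shows "{{s, t} |s t. top_split ord R s t} = {{s1, s2}}"
proof (intro equalityI subsetI)
  fix e assume "e \<in> {{s, t} |s t. top_split ord R s t}"
  then obtain s t where e: "e = {s, t}" "top_split ord R s t" by blast
  note split = top_splitD[OF e(2)]
  have "s = s1 \<or> s = s2" "t = s1 \<or> t = s2"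
    using top_split_children[OF assms] split(1-6) by simp_all
  moreover have "s \<noteq> t" using split(7) cluster_nonempty[OF split(1)] by auto
  ultimately show "e \<in> {{s1, s2}}" unfolding e(1) by auto
next
  fix e assume "e \<in> {{s1, s2}}"
  then show "e \<in> {{s, t} |s t. top_split ord R s t}"
    using assms by (intro CollectI exI[of _ s1] exI[of _ s2]) simp
qed

text \<open>If the root is removed, its child \<open>s1\<close> becomes the root instead.\<close>

definition rerooted_parent :: "'a set \<Rightarrow> 'a set \<Rightarrow> 'a set \<Rightarrow> 'a set" where
  "rerooted_parent s1 s2 s = (if s = s2 then s1 else par s)"

definition rerooted_rank :: "'a set \<Rightarrow> 'a set \<Rightarrow> nat" where
  "rerooted_rank s1 s = (if s = s1 then 0 else Suc (card (R - s)))"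

context
  fixes s1 s2 assumes split: "top_split ord R s1 s2"
begin

lemma vertices_without_root: "V = \<C> - {R}"
  using top_splitD(9)[OF split] cluster_vertex vertex_cluster by blast

lemma parent_eq_root_iff: "s \<in> V \<Longrightarrow> par s = R \<longleftrightarrow> s = s1 \<or> s = s2"
  using top_split_children[OF split, of s] top_splitD(3,6)[OF split] vertices_without_root by auto

lemma rerooted_parent_tree: "parent_tree V (rerooted_parent s1 s2) (rerooted_rank s1)"
proof
  show "rerooted_parent s1 s2 s \<in> V"
    "rerooted_rank s1 (rerooted_parent s1 s2 s) < rerooted_rank s1 s"
    if s: "s \<in> V" "0 < rerooted_rank s1 s" for s
  proof -
    have "rerooted_parent s1 s2 s \<in> V \<and>
      rerooted_rank s1 (rerooted_parent s1 s2 s) < rerooted_rank s1 s"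
    proof (cases "s = s2")
      case True
      then show ?thesis
        using s top_splitD(1,2)[OF split] vertices_without_root
        by (auto simp: rerooted_parent_def rerooted_rank_def)
    next
      case False
      then have "par s \<in> V" "s \<subset> par s"
        using s parent_eq_root_iff parent_cluster psubset_parent vertices_without_root
        by (auto simp: rerooted_rank_def)
      then show ?thesis
        using s False card_complement_less[of s "par s"] cluster_subset vertices_without_root
        by (auto simp: rerooted_parent_def rerooted_rank_def)
    qed
    then show "rerooted_parent s1 s2 s \<in> V"
      "rerooted_rank s1 (rerooted_parent s1 s2 s) < rerooted_rank s1 s" by auto
  qed
  show "s = t" if "rerooted_rank s1 s = 0" "rerooted_rank s1 t = 0" for s t
    using that by (simp add: rerooted_rank_def split: if_splits)
qed

lemma rerooted_edges: "parent_tree.edges V (rerooted_parent s1 s2) (rerooted_rank s1) = E"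
proof -
  interpret parent_tree V "rerooted_parent s1 s2" "rerooted_rank s1" by (rule rerooted_parent_tree)
  let ?C = "{s \<in> \<C>. s \<noteq> R \<and> par s \<in> V}"
  have "{s \<in> V. 0 < rerooted_rank s1 s} = V - {s1}" by (auto simp: rerooted_rank_def)
  also have "\<dots> = insert s2 (V - {s1, s2})"
    using top_splitD(4,5,7)[OF split] cluster_nonempty[of s2] vertices_without_root by auto
  also have "V - {s1, s2} = ?C"
    using parent_eq_root_iff parent_cluster unfolding vertices_without_root by auto
  finally have nonroots: "{s \<in> V. 0 < rerooted_rank s1 s} = insert s2 ?C" .
  have "rerooted_parent s1 s2 s = par s" if "par s \<in> V" for s
    using that top_splitD(6,9)[OF split] unfolding rerooted_parent_def by (cases "s = s2") simp_all
  then have "(\<lambda>s. {s, rerooted_parent s1 s2 s}) ` ?C = (\<lambda>s. {s, par s}) ` ?C"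
    by (intro image_cong) simp_all
  moreover have "{s2, rerooted_parent s1 s2 s2} = {s1, s2}"
    by (simp add: rerooted_parent_def insert_commute)
  ultimately have "edges = (\<lambda>s. {s, par s}) ` ?C \<union> {{s1, s2}}"
    unfolding edges_def nonroots by (simp only: image_insert Un_insert_right Un_empty_right)
  then show ?thesis
    unfolding tree_edges_def top_split_unique[OF split] by (simp add: setcompr_eq_image)
qed

lemma unique_path_without_root:
  assumes "v \<in> V" "w \<in> V"
  shows "\<exists>!p. is_path E v p w"
proof -
  interpret parent_tree V "rerooted_parent s1 s2" "rerooted_rank s1" by (rule rerooted_parent_tree)
  show ?thesis using ex1_path[OF assms] unfolding rerooted_edges .
qed

end

definition edge_len :: "'a set \<Rightarrow> 'a set \<Rightarrow> real" where
  "edge_len s t =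
     (if top_split ord R s t then height s + height t - 2 * height R else \<bar>height s - height t\<bar>)"

lemma edge_len_parent: "child_edge s t \<Longrightarrow> edge_len s t = height s - height t"
  using child_edge_not_split height_parent_less[of s] by (auto simp: edge_len_def child_edge_def)

lemma edge_len_symmetric: "edge_len s t = edge_len t s"
  using top_split_commute[of s t] by (simp add: edge_len_def abs_minus_commute)

lemma edge_len_positive:
  assumes "{s, t} \<in> E"
  shows "0 < edge_len s t"
proof -
  have child: "0 < edge_len s t" if "child_edge s t" for s t
    using edge_len_parent[OF that] height_parent_less that by (auto simp: child_edge_def)
  from assms consider "child_edge s t" | "child_edge t s" | "top_split ord R s t"
    unfolding edge_iff by blast
  then show ?thesis
  proof cases
    case 1
    then show ?thesis by (rule child)
  next
    case 2
    then show ?thesis using child[of t s] edge_len_symmetric[of s t] by simp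
  next
    case 3
    then show ?thesis
      using height_parent_less[of s] height_parent_less[of t] top_splitD[OF 3]
      by (simp add: edge_len_def)
  qed
qed

sublocale metric_tree V E edge_len
proof
  show "v \<in> V" if "{v, w} \<in> E" for v w
    using that cluster_vertex top_splitD(1,2) unfolding edge_iff child_edge_def by blast
  show "\<exists>!p. is_path E v p w" if "v \<in> V" "w \<in> V" for v w
  proof (cases "R \<in> V")
    case True
    then show ?thesis using unique_path_with_root that by simp
  next
    case False
    obtain a where "a \<in> R" using roots_nonempty by blast
    with False obtain s t where "top_split ord R s t" by (rule root_not_vertexE)
    then show ?thesis using unique_path_without_root that by simp
  qed
qed (use edge_len_symmetric edge_len_positive in auto)

lemma tree_path_eq_path: "tree_path ord R v w = path v w"
  by (simp add: tree_path_def path_def)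

lemma seg_parent:
  assumes "child_edge s t"
  shows "seg s t = {s, t}" "path_metric s t = height s - height t"
proof -
  have "{s, t} \<in> E" "s \<noteq> t" using edge_iff child_edge_psubset assms by auto
  then show "seg s t = {s, t}" "path_metric s t = height s - height t"
    using path_edge path_metric_edge edge_len_parent[OF assms] by (auto simp: seg_def)
qed

lemma seg_top_split:
  assumes "top_split ord R s t"
  shows "seg s t = {s, t}" "path_metric s t = height s + height t - 2 * height R"
proof -
  have "{s, t} \<in> E" "s \<noteq> t"
    using edge_iff assms top_splitD[OF assms] cluster_nonempty[of s] by auto
  then show "seg s t = {s, t}" "path_metric s t = height s + height t - 2 * height R"
    using path_edge path_metric_edge assms by (auto simp: seg_def edge_len_def)
qed

lemma parent_below_ancestor:
  assumes "v \<in> V" "w \<in> V" "v \<subset> w"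
  shows "child_edge v (par v)" "par v \<subseteq> w"
proof -
  have C: "v \<in> \<C>" "w \<in> \<C>" "v \<noteq> R" using vertex_cluster cluster_subset assms by blast+
  then show w: "par v \<subseteq> w" using parent_least assms(3) by simp
  have "par v \<in> V"
    using parent_cluster[OF C(1,3)] cluster_vertex cluster_subset[OF C(2)] assms(2) w
    by (cases "par v = R") auto
  then show "child_edge v (par v)" using C by (simp add: child_edge_def)
qed

lemma
  assumes "v \<in> V" "w \<in> V" "v \<subseteq> w"
  shows seg_ancestor: "\<And>t. t \<in> seg v w \<Longrightarrow> v \<subseteq> t \<and> t \<subseteq> w"
    and path_metric_ancestor: "path_metric v w = height v - height w"
proof -
  have "(\<forall>t \<in> seg v w. v \<subseteq> t \<and> t \<subseteq> w) \<and> path_metric v w = height v - height w"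
    using assms(1,3)
  proof (induction "card (R - v)" arbitrary: v rule: less_induct)
    case less
    show ?case
    proof (cases "v = w")
      case True
      then show ?thesis using assms(2) by (simp add: seg_def)
    next
      case False
      let ?u = "par v"
      have edge: "child_edge v ?u" and sub: "?u \<subseteq> w"
        using parent_below_ancestor less.prems assms(2) False by auto
      have u: "?u \<in> V" "?u \<subseteq> R" "v \<subset> ?u"
        using edge child_edge_psubset cluster_subset[OF vertex_cluster]
        by (auto simp: child_edge_def)
      note IH = less.hyps[OF card_complement_less[OF u(3,2)] u(1) sub]
      have "seg v ?u \<inter> seg ?u w \<subseteq> {?u}" using seg_parent(1)[OF edge] IH u(3) by auto
      then have on: "?u \<in> seg v w" using path_concat less.prems(1) u(1) assms(2) by blast
      have "v \<subseteq> t \<and> t \<subseteq> w" if "t \<in> seg v w" for t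
      proof -
        have "t = v \<or> t \<in> seg ?u w"
          using that seg_split(1)[OF less.prems(1) assms(2) on] seg_parent(1)[OF edge]
            start_in_seg[OF u(1) assms(2)] by auto
        then show ?thesis using IH u(3) less.prems(2) by blast
      qed
      moreover have "path_metric v w = height v - height w"
        using path_metric_split[OF less.prems(1) assms(2) on] seg_parent(2)[OF edge] IH by simp
      ultimately show ?thesis by blast
    qed
  qed
  then show "\<And>t. t \<in> seg v w \<Longrightarrow> v \<subseteq> t \<and> t \<subseteq> w" "path_metric v w = height v - height w"
    by auto
qed

lemma singleton_vertex:
  assumes "a \<in> R" "b \<in> R" "a \<noteq> b"
  shows "{a} \<in> V"
proof -
  have "{a} \<noteq> R" using assms by auto
  then show ?thesis using cluster_vertex singleton_cluster assms(1) by simp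
qed

lemma path_metric_leaves_via_vertex:
  assumes "a \<in> R" "b \<in> R" "a \<noteq> b" "pair_cluster a b \<in> V"
  shows "path_metric {a} {b} = 2 * leaf_height - 2 * rord (a - b)"
proof -
  let ?t = "pair_cluster a b"
  have V: "{a} \<in> V" "{b} \<in> V" using singleton_vertex assms by auto
  have sub: "{a} \<subseteq> ?t" "{b} \<subseteq> ?t"
    using left_in_pair_cluster right_in_pair_cluster assms by auto
  have "s = ?t" if "s \<in> seg {a} ?t \<inter> seg ?t {b}" for s
  proof -
    have "s \<in> seg {a} ?t" "s \<in> seg {b} ?t" using that seg_commute assms(4) V by auto
    then have s: "a \<in> s" "b \<in> s" "s \<subseteq> ?t" "s \<in> V"
      using seg_ancestor[OF V(1) assms(4) sub(1)] seg_ancestor[OF V(2) assms(4) sub(2)]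
        seg_vertices[OF V(1) assms(4)] by auto
    then show ?thesis using pair_cluster_least vertex_cluster by blast
  qed
  then have "?t \<in> seg {a} {b}" using path_concat[OF V(1) assms(4) V(2)] by blast
  then have "path_metric {a} {b} = path_metric {a} ?t + path_metric {b} ?t"
    using path_metric_split path_metric_commute V assms(4) by simp
  then show ?thesis
    using path_metric_ancestor[OF V(1) assms(4) sub(1)] path_metric_ancestor[OF V(2) assms(4) sub(2)]
      height_pair_cluster[OF assms(1-3)] by simp
qed

lemma path_metric_across_top_split:
  assumes "top_split ord R s t" "v \<in> V" "w \<in> V" "v \<subseteq> s" "w \<subseteq> t"
  shows "path_metric v w = height v + height w - 2 * height R"
proof -
  note split = top_splitD[OF assms(1)]
  have V: "s \<in> V" "t \<in> V" using split cluster_vertex by auto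
  have in_s: "u \<subseteq> s" if "u \<in> seg v s" for u
    using seg_ancestor[OF assms(2) V(1) assms(4) that] by simp
  have in_t: "u \<subseteq> t" if "u \<in> seg t w" for u
    using seg_ancestor[OF assms(3) V(2) assms(5)] seg_commute[OF assms(3) V(2)] that by simp
  have disjoint: "\<not> (u \<subseteq> s \<and> u \<subseteq> t)" if "u \<in> V" for u
    using split(7) cluster_nonempty[OF vertex_cluster[OF that]] by blast
  have "t \<notin> seg v s" using in_s disjoint[OF V(2)] by blast
  then have "seg v s \<inter> seg s t \<subseteq> {s}" using seg_top_split(1)[OF assms(1)] by auto
  then have s: "s \<in> seg v t" by (rule path_concat[OF assms(2) V])
  have "seg v t \<inter> seg t w \<subseteq> {t}"
  proof
    fix u assume u: "u \<in> seg v t \<inter> seg t w"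
    then have "u \<in> seg v s \<union> {s, t}"
      using seg_split(1)[OF assms(2) V(2) s] seg_top_split(1)[OF assms(1)] by auto
    moreover have "u \<in> V" using u seg_vertices[OF assms(2) V(2)] by blast
    then have "\<not> u \<subseteq> s" using u in_t disjoint by blast
    ultimately show "u \<in> {t}" using in_s by auto
  qed
  then have t: "t \<in> seg v w" by (rule path_concat[OF assms(2) V(2) assms(3)])
  have "path_metric v w = path_metric v s + path_metric s t + path_metric w t"
    using path_metric_split[OF assms(2,3) t] path_metric_split[OF assms(2) V(2) s]
      path_metric_commute[OF V(2) assms(3)] by simp
  then show ?thesis
    using path_metric_ancestor[OF assms(2) V(1) assms(4)] path_metric_ancestor[OF assms(3) V(2) assms(5)]
      seg_top_split(2)[OF assms(1)] by simp
qed

lemma path_metric_leaves: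
  assumes "a \<in> R" "b \<in> R" "a \<noteq> b"
  shows "path_metric {a} {b} = 2 * leaf_height - 2 * rord (a - b)"
proof (cases "pair_cluster a b \<in> V")
  case True
  then show ?thesis using path_metric_leaves_via_vertex assms by simp
next
  case False
  then have root: "pair_cluster a b = R" "R \<notin> V"
    using cluster_vertex[OF pair_cluster[OF assms]] by metis+
  obtain s t where st: "top_split ord R s t" "a \<in> s" using root_not_vertexE[OF root(2) assms(1)] .
  note split = top_splitD[OF st(1)]
  have "b \<notin> s"
    using pair_cluster_least[OF split(1) st(2)] root(1) split(2) cluster_subset[OF split(1)] by auto
  then have "b \<in> t" using split(8) assms(2) by blast
  then show ?thesis
    using path_metric_across_top_split[OF st(1), of "{a}" "{b}"] singleton_vertex assms st(2)
      height_pair_cluster[OF assms] root(1) by simp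
qed

lemma leaf_edge_unique:
  assumes "{{a}, s} \<in> E" "{{a}, t} \<in> E"
  shows "s = t"
proof -
  have no_child: "\<not> child_edge u {a}" for u
    using child_edge_psubset[of u "{a}"] cluster_nonempty[of u] by (auto simp: child_edge_def)
  have no_mix: "\<not> top_split ord R {a} u'" if "child_edge {a} u" for u u'
    using that top_splitD(3,9) unfolding child_edge_def by metis
  have "u = R - {a}" if "top_split ord R {a} u" for u
    using top_splitD(7,8)[OF that] by auto
  then show ?thesis
    using assms no_child no_mix unfolding edge_iff by (metis child_edge_def)
qed

lemma leaf_not_interior:
  assumes "v \<in> V" "w \<in> V" "{a} \<in> seg v w"
  shows "v = {a} \<or> w = {a}"
  using interior_vertex_two_edges[OF assms] leaf_edge_unique by metis

lemma seg_proper: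
  assumes "v \<in> V" "w \<in> V" "proper v" "proper w" "t \<in> seg v w"
  shows "proper t"
proof (rule ccontr)
  assume "\<not> proper t"
  moreover have "t \<in> \<C>" using seg_vertices assms vertex_cluster by blast
  ultimately obtain a where "t = {a}" by (metis not_proper_cluster_singleton)
  then have "v = {a} \<or> w = {a}" using leaf_not_interior assms by blast
  then show False using assms(3,4) by auto
qed

lemma edge_length_eq_edge_len:
  assumes "{s, t} \<in> E" "proper s" "proper t"
  shows "edge_length ord R s t = edge_len s t"
proof -
  from assms(1) consider "child_edge s t" | "child_edge t s" | "top_split ord R s t"
    unfolding edge_iff by blast
  then show ?thesis
  proof cases
    case 1
    then show ?thesis
      using edge_len_parent[OF 1] rel_depth_eq[of s] assms(2,3)
      by (simp add: edge_length_def child_edge_def)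
  next
    case 2
    then have "\<not> (s \<noteq> R \<and> t = par s)"
      using child_edge_psubset[OF 2] psubset_parent[of s] vertex_cluster
      by (auto simp: child_edge_def)
    then have "edge_length ord R s t = rel_depth ord R t"
      using 2 assms(2,3) by (auto simp: edge_length_def child_edge_def)
    then show ?thesis
      using 2 edge_len_parent[OF 2] edge_len_commute[of s t] rel_depth_eq[of t] assms(3)
      by (simp add: child_edge_def)
  next
    case 3
    note split = top_splitD[OF 3]
    have "edge_length ord R s t = rel_depth ord R s + rel_depth ord R t"
      using split assms(2,3) by (simp add: edge_length_def)
    then show ?thesis
      using rel_depth_eq[OF split(1,2) assms(2)] rel_depth_eq[OF split(4,5) assms(3)] split 3
      by (simp add: edge_len_def)
  qed
qed

lemma tree_dist_eq_path_metric:
  assumes "v \<in> V" "w \<in> V" "proper v" "proper w"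
  shows "tree_dist ord R v w = path_metric v w"
proof -
  have "successively (\<lambda>s t. {s, t} \<in> E) (path v w)"
    using is_path_path assms(1,2) by (simp add: is_path_def)
  then have "successively (\<lambda>s t. edge_length ord R s t = edge_len s t) (path v w)"
    by (rule successively_mono) (use edge_length_eq_edge_len seg_proper[OF assms] in \<open>auto simp: seg_def\<close>)
  then have "path_length (edge_length ord R) (path v w) = path_length edge_len (path v w)"
    by (rule path_length_cong)
  then show ?thesis
    by (simp add: tree_dist_def Let_def tree_path_eq_path path_metric_def path_length_def)
qed

lemma path_dist_gates:
  assumes "seg_closed A" "seg_closed B" "A \<inter> B = {}" "gates A B v w"
  shows "path_dist ord R A B = tree_dist ord R v w"
proof -
  note shortest = gates_unique_shortest[OF assms]
  have "v \<in> A" "w \<in> B" using assms(4) by (auto simp: gates_def)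
  then show ?thesis
    unfolding path_dist_def tree_path_eq_path using shortest by (intro the_equality) blast+
qed

lemma gate_proper:
  assumes "{a} \<in> V" "{b} \<in> V" "{a} \<noteq> {b}" "v \<in> seg {a} {b}" "w \<in> V" "w \<notin> seg {a} {b}"
    "seg v w \<inter> seg {a} {b} = {v}"
  shows "proper v"
proof (rule ccontr)
  assume "\<not> proper v"
  moreover have "v \<in> \<C>" using assms(1,2,4) seg_vertices vertex_cluster by blast
  ultimately obtain c where v: "v = {c}" by (metis not_proper_cluster_singleton)
  have end_false: False if "{c} \<in> V" "e \<in> V" "e \<noteq> {c}" "seg e {c} = seg {a} {b}" for e
  proof -
    have "{c} \<in> seg e w"
      using path_concat[of e "{c}" w] that assms(5,7) v by (simp add: Int_commute)
    moreover have "w \<noteq> {c}" using assms(4,6) v by blast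
    ultimately show False using leaf_not_interior that assms(5) by blast
  qed
  have "{c} = {a} \<or> {c} = {b}" using leaf_not_interior assms(1,2,4) v by blast
  then show False
    using end_false[of "{a}"] end_false[of "{b}"] assms(1-3) seg_commute by auto
qed

lemma rord_cross_value_eq_path_metric:
  assumes "{a, b, c, e} \<subseteq> R" "distinct [a, b, c, e]"
  shows "2 * rord (cross_value a b c e) =
    2 * path_metric {a} {b} + 2 * path_metric {c} {e} -
    (path_metric {a} {c} + path_metric {a} {e} + path_metric {b} {c} + path_metric {b} {e})"
  using assms rord_cross_value[OF assms(2)] by (simp add: path_metric_leaves)

lemma leaf_segs_disjoint:
  assumes "{a, b, c, e} \<subseteq> R" "distinct [a, b, c, e]" "seg {a} {b} \<inter> seg {c} {e} = {}"
  obtains v w where "v \<in> V" "w \<in> V" "proper v" "proper w" "v \<noteq> w"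
    "path_dist ord R (seg {a} {b}) (seg {c} {e}) = tree_dist ord R v w"
    "rord (cross_value a b c e) = - 2 * tree_dist ord R v w"
proof -
  have V: "{a} \<in> V" "{b} \<in> V" "{c} \<in> V" "{e} \<in> V"
    using assms(1,2) by (auto intro: singleton_vertex)
  obtain v w where gates: "gates (seg {a} {b}) (seg {c} {e}) v w"
    using gates_exist seg_vertices start_in_seg V by (metis empty_iff)
  have vw: "v \<in> seg {a} {b}" "w \<in> seg {c} {e}" "v \<in> V" "w \<in> V"
    using gates seg_vertices V by (auto simp: gates_def)
  have ne: "v \<notin> seg {c} {e}" "w \<notin> seg {a} {b}" "v \<noteq> w" using vw assms(3) by auto
  have "proper v"
    using gate_proper[OF V(1,2) _ vw(1,4) ne(2)] gates assms(2) by (simp add: gates_def)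
  moreover have "proper w"
    using gate_proper[OF V(3,4) _ vw(2,3) ne(1)] gates assms(2) seg_commute[OF vw(3,4)]
    by (simp add: gates_def)
  moreover have "rord (cross_value a b c e) = - 2 * path_metric v w"
    using rord_cross_value_eq_path_metric[OF assms(1,2)] four_point_disjoint[OF V assms(3) gates]
    by simp
  ultimately show thesis
    using that vw ne(3) path_dist_gates[OF seg_closed_seg seg_closed_seg assms(3) gates]
      tree_dist_eq_path_metric V by simp
qed

lemma leaf_segs_meet:
  assumes "{a, b, c, e} \<subseteq> R" "distinct [a, b, c, e]" "seg {a} {b} \<inter> seg {c} {e} \<noteq> {}"
  shows "0 \<le> rord (cross_value a b c e)"
proof -
  have "{a} \<in> V" "{b} \<in> V" "{c} \<in> V" "{e} \<in> V"
    using assms(1,2) by (auto intro: singleton_vertex)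
  from four_point_meet[OF this assms(3)] show ?thesis
    using rord_cross_value_eq_path_metric[OF assms(1,2)] by simp
qed

lemma tree_dist_pos:
  assumes "v \<in> V" "w \<in> V" "proper v" "proper w" "v \<noteq> w"
  shows "0 < tree_dist ord R v w"
  using path_metric_pos tree_dist_eq_path_metric assms by simp

end

section \<open>The order of the invariants\<close>

lemma sum_sublevel_set_less:
  fixes q :: "'p \<Rightarrow> 'b::linordered_idom"
  assumes "finite U" "T' \<subseteq> U" "card T' = card {P \<in> U. q P \<le> c}" "T' \<noteq> {P \<in> U. q P \<le> c}"
  shows "sum q {P \<in> U. q P \<le> c} < sum q T'"
proof -
  define T where "T = {P \<in> U. q P \<le> c}"
  have fin: "finite T" "finite T'" using assms(1,2) finite_subset by (auto simp: T_def)
  have "\<not> T' \<subseteq> T" using card_subset_eq[OF fin(1)] assms(3,4) by (auto simp: T_def)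
  then have ne: "T' - T \<noteq> {}" by auto
  have card: "card (T' - T) = card (T - T')"
    using card_Diff_subset_Int[of T' T] card_Diff_subset_Int[of T T'] fin assms(3)
    by (simp add: T_def Int_commute)
  have "sum q (T - T') \<le> of_nat (card (T - T')) * c"
    using sum_bounded_above[of "T - T'" q c] by (simp add: T_def)
  also have "\<dots> = (\<Sum>P\<in>T' - T. c)" by (simp add: card)
  also have "\<dots> < sum q (T' - T)"
    by (rule sum_strict_mono) (use ne fin assms(2) in \<open>auto simp: T_def\<close>)
  finally have "sum q (T \<inter> T') + sum q (T - T') < sum q (T' \<inter> T) + sum q (T' - T)"
    by (simp add: Int_commute)
  then have "sum q T < sum q T'"
    unfolding sum.Int_Diff[OF fin(1), symmetric] sum.Int_Diff[OF fin(2), symmetric] .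
  then show ?thesis unfolding T_def .
qed

lemma prod_partial_prods:
  fixes a :: "nat \<Rightarrow> 'b::comm_monoid_mult"
  shows "(\<Prod>k=1..n. \<Prod>m=1..k. a m) = (\<Prod>m=1..n. a m ^ (n - m + 1))"
proof (induction n)
  case (Suc n)
  have "(\<Prod>m=1..n. a m ^ (Suc n - m + 1)) = (\<Prod>m=1..n. a m ^ (n - m + 1)) * (\<Prod>m=1..n. a m)"
    unfolding prod.distrib[symmetric] by (rule prod.cong) (auto simp: Suc_diff_le mult.commute)
  also have "\<dots> * a (Suc n) = (\<Prod>k=1..Suc n. \<Prod>m=1..k. a m)"
    unfolding Suc.IH[symmetric] by (simp add: mult.assoc)
  finally show ?case by simp
qed simp

lemma sum_partial_sums:
  fixes a :: "nat \<Rightarrow> 'b::comm_semiring_1"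
  shows "(\<Sum>k=1..n. \<Sum>m=1..k. a m) = (\<Sum>m=1..n. of_nat (n - m + 1) * a m)"
proof (induction n)
  case (Suc n)
  have "(\<Sum>m=1..n. of_nat (Suc n - m + 1) * a m) = (\<Sum>m=1..n. of_nat (n - m + 1) * a m + a m)"
    by (rule sum.cong) (auto simp: Suc_diff_le algebra_simps)
  then show ?case using Suc by (simp add: sum.distrib add.assoc)
qed simp

lemma
  fixes D :: "'b::linorder set"
  assumes "finite D"
  defines "nth_largest \<equiv> (\<lambda>m. rev (sorted_list_of_set D) ! (m - 1))"
  shows rev_sorted_list_of_set_image: "nth_largest ` {1..card D} = D"
    and rev_sorted_list_of_set_strict_antimono:
      "\<And>i j. 1 \<le> i \<Longrightarrow> i < j \<Longrightarrow> j \<le> card D \<Longrightarrow> nth_largest j < nth_largest i"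
proof -
  let ?L = "rev (sorted_list_of_set D)"
  have len: "length ?L = card D" using assms by simp
  have "D = set ?L" using assms by simp
  also have "\<dots> = (\<lambda>i. ?L ! i) ` {..<card D}"
    by (auto simp: set_conv_nth len simp del: rev_nth length_rev)
  also have "{..<card D} = (\<lambda>m. m - 1) ` {1..card D}" by (force simp: image_iff)
  finally show "nth_largest ` {1..card D} = D" unfolding nth_largest_def by (simp add: image_image)
  have "sorted_wrt (<) (sorted_list_of_set D)" by (simp add: strict_sorted_iff)
  then have nth_less: "sorted_list_of_set D ! a < sorted_list_of_set D ! b"
    if "a < b" "b < card D" for a b
    using sorted_wrt_nth_less[of "(<)" "sorted_list_of_set D" a b] that assms by simp
  show "nth_largest j < nth_largest i" if "1 \<le> i" "i < j" "j \<le> card D" for i j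
    unfolding nth_largest_def using that assms nth_less[of "card D - j" "card D - i"]
    by (simp add: rev_nth)
qed

locale labelled_roots = valued_field ord for ord :: "'a::field \<Rightarrow> ereal" +
  fixes d :: nat and x :: "nat \<Rightarrow> 'a"
  assumes inj_roots: "inj_on x {1..d}" and d_pos: "0 < d"
begin

sublocale root_set ord "x ` {1..d}"
  by unfold_locales (use d_pos in auto)

abbreviation "roots \<equiv> x ` {1..d}"
abbreviation "\<Delta> \<equiv> dist_values ord d x"
abbreviation "\<delta> \<equiv> delta ord d x"
abbreviation "S \<equiv> S_pairs ord d x"

lemma dist_values_eq:
  "\<Delta> = {tree_dist ord roots v w |v w. v \<in> V \<and> w \<in> V \<and> proper v \<and> proper w \<and> v \<noteq> w}"
  by (simp add: dist_values_def Let_def)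

lemma finite_dist_values: "finite \<Delta>"
proof (rule finite_subset)
  show "\<Delta> \<subseteq> (\<lambda>(v, w). tree_dist ord roots v w) ` (V \<times> V)" unfolding dist_values_eq by auto
qed (use finite_vertices in simp)

lemma delta_image: "\<delta> ` {1..card \<Delta>} = \<Delta>"
  and delta_strict_antimono: "1 \<le> i \<Longrightarrow> i < j \<Longrightarrow> j \<le> card \<Delta> \<Longrightarrow> \<delta> j < \<delta> i"
  unfolding delta_def
  using rev_sorted_list_of_set_image[OF finite_dist_values]
    rev_sorted_list_of_set_strict_antimono[OF finite_dist_values] by auto

lemma dist_values_pos:
  assumes "D \<in> \<Delta>"
  shows "0 < D"
proof -
  obtain v w where "v \<in> V" "w \<in> V" "proper v" "proper w" "v \<noteq> w" "D = tree_dist ord roots v w"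
    using assms unfolding dist_values_eq by (elim CollectE exE conjE)
  then show ?thesis using tree_dist_pos[of v w] by simp
qed

lemma delta_pos: "m \<in> {1..card \<Delta>} \<Longrightarrow> 0 < \<delta> m"
  by (rule dist_values_pos) (use delta_image in blast)

definition quad_ord :: "nat set set \<Rightarrow> real" where
  "quad_ord P = rord (ratfun_eval x (cross_pair P))"

lemma leaf_path_eq_seg: "leaf_path ord d x i j = seg {x i} {x j}"
  unfolding leaf_path_def tree_path_eq_path seg_def ..

lemma quad_ord_cases:
  assumes "{i, j, k, l} \<subseteq> {1..d}" "distinct [i, j, k, l]"
  obtains D where "leaf_path ord d x i j \<inter> leaf_path ord d x k l = {}" "D \<in> \<Delta>"
      "path_dist ord roots (leaf_path ord d x i j) (leaf_path ord d x k l) = D"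
      "quad_ord {{i, j}, {k, l}} = - 2 * D"
  | "leaf_path ord d x i j \<inter> leaf_path ord d x k l \<noteq> {}" "0 \<le> quad_ord {{i, j}, {k, l}}"
proof -
  have distinct_roots: "{x i, x j, x k, x l} \<subseteq> roots" "distinct [x i, x j, x k, x l]"
    using assms inj_roots by (auto simp: inj_on_eq_iff)
  have quad_ord: "quad_ord {{i, j}, {k, l}} = rord (cross_value (x i) (x j) (x k) (x l))"
    unfolding quad_ord_def ratfun_eval_cross_pair[OF inj_roots assms] ..
  show thesis
  proof (cases "seg {x i} {x j} \<inter> seg {x k} {x l} = {}")
    case True
    obtain v w where vw: "v \<in> V" "w \<in> V" "proper v" "proper w" "v \<noteq> w"
      and dist: "path_dist ord roots (seg {x i} {x j}) (seg {x k} {x l}) = tree_dist ord roots v w"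
      and cross: "rord (cross_value (x i) (x j) (x k) (x l)) = - 2 * tree_dist ord roots v w"
      using leaf_segs_disjoint[OF distinct_roots True] .
    have "tree_dist ord roots v w \<in> \<Delta>" unfolding dist_values_eq using vw by blast
    then show thesis
      using that(1) True dist cross unfolding leaf_path_eq_seg quad_ord by metis
  next
    case False
    then show thesis
      using that(2) leaf_segs_meet[OF distinct_roots] unfolding leaf_path_eq_seg quad_ord by metis
  qed
qed

lemma S_pairs_eq:
  assumes "m \<in> {1..card \<Delta>}"
  shows "S m = {P \<in> quads {1..d}. quad_ord P = - 2 * \<delta> m}"
proof -
  have level_iff: "leaf_path ord d x i j \<inter> leaf_path ord d x k l = {} \<and>
      path_dist ord roots (leaf_path ord d x i j) (leaf_path ord d x k l) = \<delta> m \<longleftrightarrow>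
      quad_ord {{i, j}, {k, l}} = - 2 * \<delta> m"
    if "{i, j, k, l} \<subseteq> {1..d}" "distinct [i, j, k, l]" for i j k l
    using delta_pos[OF assms] by (cases rule: quad_ord_cases[OF that]) auto
  show ?thesis
  proof (intro equalityI subsetI)
    fix P assume "P \<in> S m"
    then obtain i j k l where P: "P = {{i, j}, {k, l}}" "{i, j, k, l} \<subseteq> {1..d}"
      "distinct [i, j, k, l]"
      "leaf_path ord d x i j \<inter> leaf_path ord d x k l = {}"
      "path_dist ord roots (leaf_path ord d x i j) (leaf_path ord d x k l) = \<delta> m"
      unfolding S_pairs_def by (elim CollectE exE conjE)
    then show "P \<in> {P \<in> quads {1..d}. quad_ord P = - 2 * \<delta> m}"
      using quadsI[OF P(2,3)] level_iff[OF P(2,3)] unfolding P(1) by blast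
  next
    fix P assume "P \<in> {P \<in> quads {1..d}. quad_ord P = - 2 * \<delta> m}"
    then obtain i j k l where P: "P = {{i, j}, {k, l}}" "{i, j, k, l} \<subseteq> {1..d}"
      "distinct [i, j, k, l]"
      "quad_ord {{i, j}, {k, l}} = - 2 * \<delta> m"
      by (elim CollectE conjE quadsE) simp
    have paths: "leaf_path ord d x i j \<inter> leaf_path ord d x k l = {}"
      "path_dist ord roots (leaf_path ord d x i j) (leaf_path ord d x k l) = \<delta> m"
      using level_iff[OF P(2,3)] P(4) by blast+
    show "P \<in> S m"
      unfolding S_pairs_def
      by (intro CollectI exI[of _ i] exI[of _ j] exI[of _ k] exI[of _ l] conjI P(1-3) paths)
  qed
qed

lemma quad_ord_neg_level:
  assumes "P \<in> quads {1..d}" "quad_ord P < 0"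
  obtains m where "m \<in> {1..card \<Delta>}" "quad_ord P = - 2 * \<delta> m"
proof -
  obtain i j k l where P: "P = {{i, j}, {k, l}}" "{i, j, k, l} \<subseteq> {1..d}" "distinct [i, j, k, l]"
    using assms(1) by (rule quadsE)
  obtain D where "D \<in> \<Delta>" "quad_ord P = - 2 * D"
    using assms(2) unfolding P(1) by (cases rule: quad_ord_cases[OF P(2,3)]) auto
  then show thesis using that delta_image by (metis imageE)
qed

definition top_pairs :: "nat \<Rightarrow> nat set set set" where
  "top_pairs k = (\<Union>m\<in>{1..k}. S m)"

lemma top_pairs_eq:
  assumes "k \<in> {1..card \<Delta>}"
  shows "top_pairs k = {P \<in> quads {1..d}. quad_ord P \<le> - 2 * \<delta> k}"
proof (intro equalityI subsetI)
  fix P assume "P \<in> top_pairs k"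
  then obtain m where "m \<in> {1..k}" "P \<in> quads {1..d}" "quad_ord P = - 2 * \<delta> m"
    using S_pairs_eq assms by (auto simp: top_pairs_def)
  then show "P \<in> {P \<in> quads {1..d}. quad_ord P \<le> - 2 * \<delta> k}"
    using delta_strict_antimono[of m k] assms by (cases "m = k") auto
next
  fix P assume "P \<in> {P \<in> quads {1..d}. quad_ord P \<le> - 2 * \<delta> k}"
  then have P: "P \<in> quads {1..d}" "quad_ord P \<le> - 2 * \<delta> k" by auto
  then have "quad_ord P < 0" using delta_pos[OF assms] by simp
  then obtain m where m: "m \<in> {1..card \<Delta>}" "quad_ord P = - 2 * \<delta> m"
    using quad_ord_neg_level[OF P(1)] by blast
  then have "m \<le> k"
    using delta_strict_antimono[of k m] P(2) assms by (force simp: not_le[symmetric])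
  moreover have "P \<in> S m" using m P(1) S_pairs_eq[OF m(1)] by simp
  ultimately show "P \<in> top_pairs k" unfolding top_pairs_def using m(1) by auto
qed

lemma top_pairs_quads: "n \<le> card \<Delta> \<Longrightarrow> k \<in> {1..n} \<Longrightarrow> top_pairs k \<subseteq> quads {1..d}"
  using top_pairs_eq[of k] by auto

lemma S_pairs_disjoint:
  assumes "i \<in> {1..card \<Delta>}" "j \<in> {1..card \<Delta>}" "i \<noteq> j"
  shows "S i \<inter> S j = {}"
proof -
  have "\<delta> i \<noteq> \<delta> j"
    using delta_strict_antimono[of i j] delta_strict_antimono[of j i] assms by (cases "i < j") auto
  then show ?thesis using S_pairs_eq assms by auto
qed

lemma finite_S_pairs: "m \<in> {1..card \<Delta>} \<Longrightarrow> finite (S m)"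
  using S_pairs_eq finite_quads[of "{1..d}"] by simp

lemma sum_top_pairs: "k \<le> card \<Delta> \<Longrightarrow> sum h (top_pairs k) = (\<Sum>m=1..k. sum h (S m))"
  and prod_top_pairs: "k \<le> card \<Delta> \<Longrightarrow> prod h' (top_pairs k) = (\<Prod>m=1..k. prod h' (S m))"
  unfolding top_pairs_def
  by (rule sum.UNION_disjoint prod.UNION_disjoint; use finite_S_pairs S_pairs_disjoint in auto)+

lemma R_fun_eq_cross_prod:
  assumes "n \<le> card \<Delta>"
  shows "R_fun ord d x n = cross_prod top_pairs n"
proof -
  have "R_fun ord d x n = (\<Prod>m=1..n. (\<Prod>P\<in>S m. cross_pair P) ^ (n - m + 1))"
    by (simp only: R_fun_def prod_power_distrib)
  also have "\<dots> = (\<Prod>k=1..n. \<Prod>m=1..k. \<Prod>P\<in>S m. cross_pair P)"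
    by (rule prod_partial_prods[symmetric])
  also have "\<dots> = cross_prod top_pairs n"
    unfolding cross_prod_def
    by (intro prod.cong refl prod_top_pairs[symmetric]) (use assms in simp)
  finally show ?thesis .
qed

lemma eval_cross_pair_nonzero:
  assumes "P \<in> quads {1..d}"
  shows "ratfun_eval x (cross_pair P) \<noteq> 0"
  using assms
proof (rule quadsE)
  fix i j k l assume P: "P = {{i, j}, {k, l}}" "{i, j, k, l} \<subseteq> {1..d}" "distinct [i, j, k, l]"
  then have "distinct [x i, x j, x k, x l]" using inj_roots by (auto simp: inj_on_eq_iff)
  then show ?thesis
    unfolding P(1) ratfun_eval_cross_pair[OF inj_roots P(2,3)] by (rule cross_value_nonzero)
qed

lemma
  assumes "\<And>k. k \<in> {1..n} \<Longrightarrow> T k \<subseteq> quads {1..d}"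
  shows eval_cross_prod_nonzero: "ratfun_eval x (cross_prod T n) \<noteq> 0"
    and rord_eval_cross_prod: "rord (ratfun_eval x (cross_prod T n)) = (\<Sum>k=1..n. sum quad_ord (T k))"
proof -
  have eval: "ratfun_eval x (cross_prod T n) = (\<Prod>k=1..n. \<Prod>P\<in>T k. ratfun_eval x (cross_pair P))"
    by (rule ratfun_eval_cross_prod[OF inj_roots assms])
  have nonzero: "ratfun_eval x (cross_pair P) \<noteq> 0" if "k \<in> {1..n}" "P \<in> T k" for k P
    using eval_cross_pair_nonzero assms that by blast
  have finite: "finite (T k)" if "k \<in> {1..n}" for k
    using finite_subset[OF assms[OF that]] finite_quads by blast
  have inner_nonzero: "(\<Prod>P\<in>T k. ratfun_eval x (cross_pair P)) \<noteq> 0" if "k \<in> {1..n}" for k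
    using nonzero[OF that] finite[OF that] by (simp add: prod_zero_iff)
  then show "ratfun_eval x (cross_prod T n) \<noteq> 0" unfolding eval by (simp add: prod_zero_iff)
  have "rord (ratfun_eval x (cross_prod T n)) =
      (\<Sum>k=1..n. rord (\<Prod>P\<in>T k. ratfun_eval x (cross_pair P)))"
    unfolding eval by (rule rord_prod) (rule inner_nonzero)
  also have "\<dots> = (\<Sum>k=1..n. sum quad_ord (T k))"
    unfolding quad_ord_def by (intro sum.cong refl rord_prod nonzero)
  finally show "rord (ratfun_eval x (cross_prod T n)) = (\<Sum>k=1..n. sum quad_ord (T k))" .
qed

lemma perm_act_R_fun:
  assumes "\<sigma> permutes {1..d}" "n \<le> card \<Delta>"
  shows "perm_act \<sigma> (R_fun ord d x n) = cross_prod (\<lambda>k. act \<sigma> ` top_pairs k) n"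
  unfolding R_fun_eq_cross_prod[OF assms(2)]
  by (rule perm_act_cross_prod[of _ _ _ "{1..d}"])
    (use permutes_inj[OF assms(1)] top_pairs_quads[OF assms(2)] in auto)

lemma permuted_top_pairs_quads:
  assumes "\<sigma> permutes {1..d}" "n \<le> card \<Delta>" "k \<in> {1..n}"
  shows "act \<sigma> ` top_pairs k \<subseteq> quads {1..d}"
proof -
  have "act \<sigma> P \<in> quads {1..d}" if "P \<in> quads {1..d}" for P
    using act_quads[OF _ _ that] permutes_inj_on[OF assms(1)] permutes_image[OF assms(1)] by simp
  then show ?thesis using top_pairs_quads[OF assms(2,3)] by blast
qed

lemma sum_permuted_top_pairs_less:
  assumes "\<sigma> permutes {1..d}" "n \<le> card \<Delta>" "k \<in> {1..n}" "act \<sigma> ` top_pairs k \<noteq> top_pairs k"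
  shows "sum quad_ord (top_pairs k) < sum quad_ord (act \<sigma> ` top_pairs k)"
proof -
  have top: "top_pairs k = {P \<in> quads {1..d}. quad_ord P \<le> - 2 * \<delta> k}"
    using top_pairs_eq assms(2,3) by simp
  have "card (act \<sigma> ` top_pairs k) = card (top_pairs k)"
    by (rule card_image) (use inj_act[OF permutes_inj[OF assms(1)]] inj_on_subset in blast)
  then show ?thesis
    using sum_sublevel_set_less[of "quads {1..d}" "act \<sigma> ` top_pairs k" quad_ord "- 2 * \<delta> k"]
      finite_quads[of "{1..d}"] permuted_top_pairs_quads[OF assms(1-3)] assms(4)
    unfolding top by simp
qed

lemma R_fun_unique_minimum:
  assumes "\<sigma> permutes {1..d}" "n \<le> card \<Delta>" "perm_act \<sigma> (R_fun ord d x n) \<noteq> R_fun ord d x n"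
  shows "ord (ratfun_eval x (R_fun ord d x n)) < ord (ratfun_eval x (perm_act \<sigma> (R_fun ord d x n)))"
proof -
  note less = sum_permuted_top_pairs_less[OF assms(1,2)]
  have "cross_prod (\<lambda>k. act \<sigma> ` top_pairs k) n \<noteq> cross_prod top_pairs n"
    using assms(3) perm_act_R_fun[OF assms(1,2)] R_fun_eq_cross_prod[OF assms(2)] by metis
  then obtain k0 where k0: "k0 \<in> {1..n}" "act \<sigma> ` top_pairs k0 \<noteq> top_pairs k0"
    using cross_prod_cong[of n "\<lambda>k. act \<sigma> ` top_pairs k" top_pairs] by blast
  have "sum quad_ord (top_pairs k) \<le> sum quad_ord (act \<sigma> ` top_pairs k)" if "k \<in> {1..n}" for k
    using less[OF that] by (cases "act \<sigma> ` top_pairs k = top_pairs k") simp_all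
  then have "(\<Sum>k=1..n. sum quad_ord (top_pairs k)) < (\<Sum>k=1..n. sum quad_ord (act \<sigma> ` top_pairs k))"
    using less[OF k0] k0(1) by (intro sum_strict_mono_ex1) blast+
  then have "rord (ratfun_eval x (cross_prod top_pairs n)) <
      rord (ratfun_eval x (cross_prod (\<lambda>k. act \<sigma> ` top_pairs k) n))"
    using rord_eval_cross_prod[OF top_pairs_quads[OF assms(2)]]
      rord_eval_cross_prod[OF permuted_top_pairs_quads[OF assms(1,2)]] by simp
  then show ?thesis
    unfolding perm_act_R_fun[OF assms(1,2)] unfolding R_fun_eq_cross_prod[OF assms(2)]
    using eval_cross_prod_nonzero[OF top_pairs_quads[OF assms(2)]]
      eval_cross_prod_nonzero[OF permuted_top_pairs_quads[OF assms(1,2)]] by (simp add: ord_eq_rord)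
qed

lemma ord_eval_R_fun:
  assumes "n \<le> card \<Delta>"
  shows "ord (ratfun_eval x (R_fun ord d x n)) =
    ereal (- 2 * (\<Sum>m=1..n. real (K_count ord d x m) * real (n + 1 - m) * \<delta> m))"
proof -
  note quads = top_pairs_quads[OF assms]
  have "rord (ratfun_eval x (R_fun ord d x n)) = (\<Sum>k=1..n. sum quad_ord (top_pairs k))"
    unfolding R_fun_eq_cross_prod[OF assms] by (rule rord_eval_cross_prod[OF quads])
  also have "\<dots> = (\<Sum>k=1..n. \<Sum>m=1..k. sum quad_ord (S m))"
    by (intro sum.cong refl sum_top_pairs) (use assms in simp)
  also have "\<dots> = (\<Sum>m=1..n. real (n - m + 1) * sum quad_ord (S m))"
    by (rule sum_partial_sums)
  also have "\<dots> = (\<Sum>m=1..n. - 2 * (real (K_count ord d x m) * real (n + 1 - m) * \<delta> m))"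
  proof (rule sum.cong[OF refl])
    fix m assume m: "m \<in> {1..n}"
    then have "sum quad_ord (S m) = real (K_count ord d x m) * (- 2 * \<delta> m)"
      using S_pairs_eq[of m] assms by (simp add: K_count_def)
    then show "real (n - m + 1) * sum quad_ord (S m) =
        - 2 * (real (K_count ord d x m) * real (n + 1 - m) * \<delta> m)"
      using m by (simp add: Suc_diff_le)
  qed
  finally show ?thesis
    using eval_cross_prod_nonzero[OF quads] R_fun_eq_cross_prod[OF assms]
    by (simp add: ord_eq_rord sum_distrib_left)
qed

lemma ord_eval_Inv:
  assumes "n \<le> card \<Delta>"
  shows "ord (ratfun_eval x (Inv ord d x n)) = ord (ratfun_eval x (R_fun ord d x n))"
proof -
  define orbit where "orbit = {perm_act \<sigma> (R_fun ord d x n) |\<sigma>. \<sigma> permutes {1..d}}"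
  have "orbit = (\<lambda>\<sigma>. perm_act \<sigma> (R_fun ord d x n)) ` {\<sigma>. \<sigma> permutes {1..d}}"
    unfolding orbit_def by auto
  then have fin: "finite orbit" using finite_permutations[of "{1..d}"] by simp
  have "perm_act id (R_fun ord d x n) = R_fun ord d x n"
    using perm_act_R_fun[OF permutes_id assms] R_fun_eq_cross_prod[OF assms] by simp
  then have R: "R_fun ord d x n \<in> orbit"
    unfolding orbit_def using permutes_id by (intro CollectI exI[of _ id]) simp
  have regular: "regular_at x r" and nonzero: "ratfun_eval x r \<noteq> 0" if "r \<in> orbit" for r
    using that perm_act_R_fun assms regular_at_cross_prod[OF inj_roots] eval_cross_prod_nonzero
      permuted_top_pairs_quads
    unfolding orbit_def by auto
  have "ratfun_eval x (Inv ord d x n) = (\<Sum>r\<in>orbit. ratfun_eval x r)"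
    unfolding Inv_def orbit_def[symmetric] by (rule ratfun_eval_sum) (rule regular)
  also have "ord \<dots> = ord (ratfun_eval x (R_fun ord d x n))"
  proof (rule ord_sum_unique_min[OF fin R])
    show "ratfun_eval x (R_fun ord d x n) \<noteq> 0" using nonzero R .
    show "ord (ratfun_eval x (R_fun ord d x n)) < ord (ratfun_eval x r)"
      if "r \<in> orbit" "r \<noteq> R_fun ord d x n" for r
      using that R_fun_unique_minimum assms unfolding orbit_def by auto
  qed
  finally show ?thesis .
qed

end

theorem theorem5p2:
  fixes v :: "'k::field \<Rightarrow> ereal"
    and ord :: "'k alg_closure \<Rightarrow> ereal"
    and f :: "'k poly"
    and x :: "nat \<Rightarrow> 'k alg_closure"
    and g d n :: nat
  assumes "local_field v"
    and "odd (residue_char v)"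
    and "valuation ord"
    and "\<forall>a. ord (to_ac a) = v a"
    and "2 \<le> g"
    and "d = 2 * g + 2"
    and "squarefree f"
    and "degree f = d"
    and "bij_betw x {1..d} {z. poly (map_poly to_ac f) z = 0}"
    and "\<not> potentially_good_reduction ord g f"
    and "1 \<le> n"
    and "n \<le> n_dist ord d x"
  shows "ord (ratfun_eval x (Inv ord d x n)) =
    ereal (- 2 * (\<Sum>m=1..n. real (K_count ord d x m) * real (n + 1 - m) * delta ord d x m))"
proof -
  interpret labelled_roots ord d x
    by unfold_locales (use assms in \<open>auto simp: bij_betw_def\<close>)
  have "n \<le> card (dist_values ord d x)" using assms(12) by (simp only: n_dist_def)
  then show ?thesis using ord_eval_Inv ord_eval_R_fun by simp
qed

end
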